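(* The subgroup of $\mathrm{Out}(\mathcal O_2)$ generated by (the classes of) the automorphisms $\lambda_A$ and $\lambda_F$ is isomorphic to the infinite dihedral group $\mathbb Z\rtimes\mathbb Z_2$.
   Context: $\mathcal O_2$ is the Cuntz algebra, generated by isometries $S_1,S_2$ with $S_1S_1^*+S_2S_2^*=1$. $W_2^k$ is the set of words of length $k$ in $\{1,2\}$, $S_\alpha=S_{\alpha_1}\cdots S_{\alpha_k}$. To a permutation $\sigma$ of $W_2^k$ corresponds the unitary $\sum_{\alpha\in W_2^k}S_{\sigma(\alpha)}S_\alpha^*$, denoted by the same letter. For a unitary $u\in\mathcal O_2$, $\lambda_u$ is the unital endomorphism with $\lambda_u(S_i)=u^*S_i$. $\mathrm{Out}(\mathcal O_2)=\mathrm{Aut}(\mathcal O_2)/\mathrm{Inn}(\mathcal O_2)$. $F=S_1S_2^*+S_2S_1^*$ (so $\lambda_F$ exchanges $S_1$ and $S_2$). $A$ is the permutation of $W_2^4$ fixing $1211,1212,1222,1221,1121,1122$, with $1111\mapsto1112$, $1112\mapsto1111$, $2222\mapsto2111$, $2221\mapsto2121$, $2211\mapsto2112$, $2212\mapsto2122$, $2122\mapsto2222$, $2121\mapsto2221$, $2112\mapsto2212$, $2111\mapsto2211$. The endomorphisms $\lambda_F$ and $\lambda_A$ are automorphisms of $\mathcal O_2$. *)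

theory Defs
  imports
    Complex_Main
    "HOL-Algebra.Elementary_Groups"
    "HOL-Algebra.Generated_Groups"
    "HOL-Combinatorics.Permutations"
begin

section \<open>Unital C*-algebras\<close>

text \<open>
  The superclasses supply a real Banach algebra with \<open>norm 1 = 1\<close> (so \<open>1 \<noteq> 0\<close>) and a
  submultiplicative norm; complex scalars and the involution are added here.
\<close>

class unital_cstar_algebra = real_normed_algebra_1 + banach +
  fixes scaleC :: "complex \<Rightarrow> 'a \<Rightarrow> 'a"
    and adj :: "'a \<Rightarrow> 'a"
  assumes scaleC_of_real: "scaleC (complex_of_real r) x = scaleR r x"
    and scaleC_add_right: "scaleC c (x + y) = scaleC c x + scaleC c y"
    and scaleC_add_left: "scaleC (c + d) x = scaleC c x + scaleC d x"
    and scaleC_scaleC: "scaleC c (scaleC d x) = scaleC (c * d) x"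
    and scaleC_mult_left: "scaleC c x * y = scaleC c (x * y)"
    and scaleC_mult_right: "x * scaleC c y = scaleC c (x * y)"
    and norm_scaleC: "norm (scaleC c x) = cmod c * norm x"
    and adj_add: "adj (x + y) = adj x + adj y"
    and adj_scaleC: "adj (scaleC c x) = scaleC (cnj c) (adj x)"
    and adj_mult: "adj (x * y) = adj y * adj x"
    and adj_adj: "adj (adj x) = x"
    and cstar_identity: "norm (adj x * x) = (norm x)\<^sup>2"

lemma adj_one [simp]: "adj (1 :: 'a::unital_cstar_algebra) = 1"
  by (metis adj_adj adj_mult mult_1 mult_1_right)

definition is_unitary :: "'a::unital_cstar_algebra \<Rightarrow> bool" where
  "is_unitary u \<longleftrightarrow> adj u * u = 1 \<and> u * adj u = 1"

definition star_endomorphism :: "('a::unital_cstar_algebra \<Rightarrow> 'a) \<Rightarrow> bool" where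
  "star_endomorphism \<phi> \<longleftrightarrow>
     (\<forall>x y. \<phi> (x + y) = \<phi> x + \<phi> y) \<and>
     (\<forall>c x. \<phi> (scaleC c x) = scaleC c (\<phi> x)) \<and>
     (\<forall>x y. \<phi> (x * y) = \<phi> x * \<phi> y) \<and>
     (\<forall>x. \<phi> (adj x) = adj (\<phi> x)) \<and>
     \<phi> 1 = 1"

definition cstar_subalgebra :: "'a::unital_cstar_algebra set \<Rightarrow> bool" where
  "cstar_subalgebra B \<longleftrightarrow>
     closed B \<and> 1 \<in> B \<and>
     (\<forall>x\<in>B. \<forall>y\<in>B. x + y \<in> B) \<and>
     (\<forall>c. \<forall>x\<in>B. scaleC c x \<in> B) \<and>
     (\<forall>x\<in>B. \<forall>y\<in>B. x * y \<in> B) \<and>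
     (\<forall>x\<in>B. adj x \<in> B)"


section \<open>Automorphisms, inner automorphisms and outer automorphisms\<close>

definition Aut :: "('a::unital_cstar_algebra \<Rightarrow> 'a) monoid" where
  "Aut = \<lparr>carrier = {\<phi>. star_endomorphism \<phi> \<and> bij \<phi>}, monoid.mult = (\<circ>), one = id\<rparr>"

definition Ad :: "'a::unital_cstar_algebra \<Rightarrow> 'a \<Rightarrow> 'a" where
  "Ad u x = u * x * adj u"

definition Inn :: "('a::unital_cstar_algebra \<Rightarrow> 'a) set" where
  "Inn = {Ad u | u. is_unitary u}"

definition Out :: "('a::unital_cstar_algebra \<Rightarrow> 'a) set monoid" where
  "Out = Aut Mod Inn"

definition out_class :: "('a::unital_cstar_algebra \<Rightarrow> 'a) \<Rightarrow> ('a \<Rightarrow> 'a) set" where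
  "out_class \<phi> = Inn #>\<^bsub>Aut\<^esub> \<phi>"

lemma star_endomorphism_inv:
  assumes "star_endomorphism \<phi>" "bij \<phi>"
  shows "star_endomorphism (inv_into UNIV \<phi>)"
proof -
  have s: "\<And>y. \<phi> (inv_into UNIV \<phi> y) = y"
    using assms(2) by (simp add: bij_is_surj surj_f_inv_f)
  have e: "inv_into UNIV \<phi> y = x" if "\<phi> x = y" for x y
    using that assms(2) by (metis bij_inv_eq_iff)
  show ?thesis
    using assms(1) unfolding star_endomorphism_def
    by (auto intro!: e simp: s)
qed

lemma group_Aut: "group (Aut :: ('a::unital_cstar_algebra \<Rightarrow> 'a) monoid)"
proof (rule groupI)
  fix x :: "'a \<Rightarrow> 'a" assume x: "x \<in> carrier Aut"
  have "inv_into UNIV x \<in> carrier Aut" "inv_into UNIV x \<circ> x = id"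
    using x by (auto simp: Aut_def star_endomorphism_inv bij_imp_bij_inv bij_is_inj)
  then show "\<exists>y\<in>carrier Aut. y \<otimes>\<^bsub>Aut\<^esub> x = \<one>\<^bsub>Aut\<^esub>"
    by (auto simp: Aut_def)
qed (auto simp: Aut_def star_endomorphism_def bij_comp o_assoc)

lemma Ad_comp: "Ad u \<circ> Ad v = Ad (u * v)"
  by (auto simp: Ad_def fun_eq_iff adj_mult mult.assoc)

lemma Ad_one: "Ad 1 = id"
  by (auto simp: Ad_def)

lemma is_unitary_mult: "is_unitary u \<Longrightarrow> is_unitary v \<Longrightarrow> is_unitary (u * v)"
  unfolding is_unitary_def adj_mult by (metis mult.assoc mult_1_right)

lemma is_unitary_adj: "is_unitary u \<Longrightarrow> is_unitary (adj u)"
  by (simp add: is_unitary_def adj_adj)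

lemma Ad_in_Aut:
  assumes "is_unitary u"
  shows "Ad u \<in> carrier Aut"
proof -
  have u: "adj u * u = 1" "u * adj u = 1"
    using assms by (auto simp: is_unitary_def)
  have "bij (Ad u)"
    by (rule o_bij[of "Ad (adj u)"]) (simp_all add: Ad_comp u Ad_one)
  moreover have "u * (x * y) * adj u = (u * x * adj u) * (u * y * adj u)" for x y
    by (metis u(1) mult.assoc mult_1_left)
  ultimately show ?thesis
    by (auto simp: Aut_def star_endomorphism_def Ad_def u distrib_left distrib_right
        scaleC_mult_left scaleC_mult_right adj_mult adj_adj mult.assoc)
qed

lemma normal_Inn: "Inn \<lhd> (Aut :: ('a::unital_cstar_algebra \<Rightarrow> 'a) monoid)"
proof -
  interpret A: group "Aut :: ('a \<Rightarrow> 'a) monoid" by (rule group_Aut)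
  have inv: "inv\<^bsub>Aut\<^esub> Ad u = Ad (adj u)" if "is_unitary u" for u :: 'a
    using that Ad_in_Aut[OF that] Ad_in_Aut[OF is_unitary_adj[OF that]]
    by (intro A.inv_equality) (auto simp: Aut_def Ad_comp Ad_one is_unitary_def)
  have "subgroup Inn (Aut :: ('a \<Rightarrow> 'a) monoid)"
  proof (rule A.subgroupI)
    show "Inn \<noteq> ({} :: ('a \<Rightarrow> 'a) set)"
      by (auto simp: Inn_def is_unitary_def intro!: exI[of _ 1])
  next
    fix f :: "'a \<Rightarrow> 'a" assume "f \<in> Inn"
    then show "inv\<^bsub>Aut\<^esub> f \<in> Inn"
      by (auto simp: Inn_def inv intro: is_unitary_adj)
  next
    fix f g :: "'a \<Rightarrow> 'a" assume "f \<in> Inn" "g \<in> Inn"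
    then show "f \<otimes>\<^bsub>Aut\<^esub> g \<in> Inn"
      by (auto simp: Inn_def Aut_def Ad_comp intro: is_unitary_mult)
  qed (auto simp: Inn_def Ad_in_Aut)
  moreover have "x \<otimes>\<^bsub>Aut\<^esub> f \<otimes>\<^bsub>Aut\<^esub> inv\<^bsub>Aut\<^esub> x \<in> Inn"
    if x: "x \<in> carrier Aut" and f: "f \<in> Inn" for x f :: "'a \<Rightarrow> 'a"
  proof -
    obtain u where u: "is_unitary u" "f = Ad u" using f by (auto simp: Inn_def)
    have h: "star_endomorphism x" using x by (auto simp: Aut_def)
    have xu: "is_unitary (x u)"
      using u(1) h unfolding is_unitary_def star_endomorphism_def by metis
    have c: "x \<circ> Ad u = Ad (x u) \<circ> x"
      using h by (auto simp: star_endomorphism_def Ad_def fun_eq_iff)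
    have "x \<otimes>\<^bsub>Aut\<^esub> Ad u = Ad (x u) \<otimes>\<^bsub>Aut\<^esub> x"
      using c by (simp add: Aut_def)
    then have "x \<otimes>\<^bsub>Aut\<^esub> f \<otimes>\<^bsub>Aut\<^esub> inv\<^bsub>Aut\<^esub> x = Ad (x u)"
      using x u Ad_in_Aut[OF xu] by (simp add: A.m_assoc)
    then show ?thesis using xu by (auto simp: Inn_def)
  qed
  ultimately show ?thesis
    using A.normal_inv_iff by blast
qed


section \<open>The Cuntz algebra on two generators\<close>

text \<open>
  \<open>cuntz_O2 S\<close> says that the whole algebra \<^typ>\<open>'a\<close> is generated, as a C*-algebra, by the two
  isometries \<open>S 1\<close>, \<open>S 2\<close> satisfying the Cuntz relation. By Cuntz's uniqueness theorem all such
  algebras are canonically isomorphic, so that \<^typ>\<open>'a\<close> is \<open>O\<^sub>2\<close>. The generators are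
  indexed by \<^typ>\<open>nat\<close>; values of \<open>S\<close> outside \<open>{1, 2}\<close> are irrelevant.
\<close>

definition cuntz_O2 :: "(nat \<Rightarrow> 'a::unital_cstar_algebra) \<Rightarrow> bool" where
  "cuntz_O2 S \<longleftrightarrow>
     adj (S 1) * S 1 = 1 \<and> adj (S 2) * S 2 = 1 \<and>
     S 1 * adj (S 1) + S 2 * adj (S 2) = 1 \<and>
     cstar_subalgebra hull {S 1, S 2} = UNIV"

definition words :: "nat \<Rightarrow> nat list set" where
  "words k = {\<alpha>. length \<alpha> = k \<and> set \<alpha> \<subseteq> {1, 2}}"

definition S_word :: "(nat \<Rightarrow> 'a::unital_cstar_algebra) \<Rightarrow> nat list \<Rightarrow> 'a" where
  "S_word S \<alpha> = prod_list (map S \<alpha>)"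

definition perm_unitary ::
  "(nat \<Rightarrow> 'a::unital_cstar_algebra) \<Rightarrow> nat \<Rightarrow> (nat list \<Rightarrow> nat list) \<Rightarrow> 'a" where
  "perm_unitary S k \<sigma> = (\<Sum>\<alpha>\<in>words k. S_word S (\<sigma> \<alpha>) * adj (S_word S \<alpha>))"

text \<open>
  For unitary \<open>u\<close> in \<open>O\<^sub>2\<close> exactly one unital *-endomorphism satisfies the
  defining property (Cuntz).
\<close>

definition cuntz_endo :: "(nat \<Rightarrow> 'a::unital_cstar_algebra) \<Rightarrow> 'a \<Rightarrow> 'a \<Rightarrow> 'a" where
  "cuntz_endo S u =
     (THE \<phi>. star_endomorphism \<phi> \<and> (\<forall>i\<in>{1, 2}. \<phi> (S i) = adj u * S i))"

definition F_unitary :: "(nat \<Rightarrow> 'a::unital_cstar_algebra) \<Rightarrow> 'a" where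
  "F_unitary S = S 1 * adj (S 2) + S 2 * adj (S 1)"

definition A_table :: "(nat list \<times> nat list) list" where
  "A_table =
    [([1,1,1,1], [1,1,1,2]),
     ([1,1,1,2], [1,1,1,1]),
     ([2,2,2,2], [2,1,1,1]),
     ([2,2,2,1], [2,1,2,1]),
     ([2,2,1,1], [2,1,1,2]),
     ([2,2,1,2], [2,1,2,2]),
     ([2,1,2,2], [2,2,2,2]),
     ([2,1,2,1], [2,2,2,1]),
     ([2,1,1,2], [2,2,1,2]),
     ([2,1,1,1], [2,2,1,1])]"

definition A_perm :: "nat list \<Rightarrow> nat list" where
  "A_perm \<alpha> = (case map_of A_table \<alpha> of Some \<beta> \<Rightarrow> \<beta> | None \<Rightarrow> \<alpha>)"

lemma A_perm_permutes: "A_perm permutes words 4"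
proof -
  let ?D = "fst ` set A_table"
  have im: "A_perm ` ?D = ?D"
    by (simp add: A_table_def A_perm_def) blast
  have "finite ?D" by simp
  then have "bij_betw A_perm ?D ?D"
    using im by (metis bij_betw_def eq_card_imp_inj_on)
  moreover have "A_perm x = x" if "x \<notin> ?D" for x
    using that by (simp add: A_perm_def map_of_eq_None_iff[THEN iffD2])
  ultimately have "A_perm permutes ?D"
    by (rule bij_imp_permutes)
  moreover have "?D \<subseteq> words 4"
    by (simp add: A_table_def words_def)
  ultimately show ?thesis by (rule permutes_subset)
qed


section \<open>The infinite dihedral group\<close>

definition semidirect_product ::
  "('n, 'x) monoid_scheme \<Rightarrow> ('h, 'y) monoid_scheme \<Rightarrow> ('h \<Rightarrow> 'n \<Rightarrow> 'n) \<Rightarrow> ('n \<times> 'h) monoid" where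
  "semidirect_product N H \<theta> =
     \<lparr>carrier = carrier N \<times> carrier H,
      monoid.mult = (\<lambda>(m, s) (n, t). (m \<otimes>\<^bsub>N\<^esub> \<theta> s n, s \<otimes>\<^bsub>H\<^esub> t)),
      one = (\<one>\<^bsub>N\<^esub>, \<one>\<^bsub>H\<^esub>)\<rparr>"

definition infinite_dihedral :: "(int \<times> int) monoid" where
  "infinite_dihedral =
     semidirect_product integer_group (integer_mod_group 2) (\<lambda>s n. if s = 0 then n else - n)"

lemma carrier_infinite_dihedral: "carrier infinite_dihedral = UNIV \<times> {0, 1}"
proof -
  have "{0..<2} = {0, 1 :: int}" by auto
  then show ?thesis
    by (simp add: infinite_dihedral_def semidirect_product_def carrier_integer_mod_group)
qed

lemma group_infinite_dihedral: "group infinite_dihedral"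
proof (rule groupI)
  fix x assume "x \<in> carrier infinite_dihedral"
  then obtain m s where x: "x = (m, s)" "s = 0 \<or> s = 1"
    by (auto simp: carrier_infinite_dihedral)
  then show "\<exists>y\<in>carrier infinite_dihedral.
      y \<otimes>\<^bsub>infinite_dihedral\<^esub> x = \<one>\<^bsub>infinite_dihedral\<^esub>"
    unfolding carrier_infinite_dihedral
    by (intro bexI[of _ "(if s = 0 then - m else m, s)"])
       (auto simp: infinite_dihedral_def semidirect_product_def)
next
  fix x y z
  assume "x \<in> carrier infinite_dihedral" "y \<in> carrier infinite_dihedral"
    "z \<in> carrier infinite_dihedral"
  then show "x \<otimes>\<^bsub>infinite_dihedral\<^esub> y \<otimes>\<^bsub>infinite_dihedral\<^esub> z =
      x \<otimes>\<^bsub>infinite_dihedral\<^esub> (y \<otimes>\<^bsub>infinite_dihedral\<^esub> z)"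
    unfolding carrier_infinite_dihedral
    by (auto simp: infinite_dihedral_def semidirect_product_def)
next
  fix x y
  assume "x \<in> carrier infinite_dihedral" "y \<in> carrier infinite_dihedral"
  then show "x \<otimes>\<^bsub>infinite_dihedral\<^esub> y \<in> carrier infinite_dihedral"
    unfolding carrier_infinite_dihedral
    by (auto simp: infinite_dihedral_def semidirect_product_def)
qed (auto simp: infinite_dihedral_def semidirect_product_def carrier_integer_mod_group)

end

theory Submission
  imports Defs "HOL-Computational_Algebra.Formal_Power_Series"
begin

text \<open>
  Write \<open>f\<close> and \<open>x\<close> for the outer classes of \<open>\<lambda>\<^sub>F\<close> and \<open>\<lambda>\<^sub>A\<close>. Three facts imply the theorem
  (\<open>generate_iso_infinite_dihedral\<close>): \<open>f\<^sup>2 = 1\<close>, \<open>(f x)\<^sup>2 = 1\<close>, and \<open>x\<close> has infinite order. The first one holds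
  already for the automorphisms, as \<open>\<lambda>\<^sub>F\<close> exchanges the generators.

  For \<open>\<lambda>\<^sub>u\<close> to be a meaningful object one needs Cuntz's theorem that any two isometries satisfying the Cuntz
  relations are the images of \<open>S\<^sub>1, S\<^sub>2\<close> under exactly one *-endomorphism. Uniqueness follows from the
  contractivity of *-endomorphisms (\<open>star_endo_contractive\<close>). For existence (\<open>cuntz_universal\<close>) it is enough that a
  *-polynomial has norms at the two families that differ at most by a factor growing slowly
  along the powers of \<open>x\<^sup>* x\<close>, because the C*-identity \<open>\<parallel>x\<parallel>\<^sup>2\<^sup>n = \<parallel>(x\<^sup>* x)\<^sup>n\<parallel>\<close> (for \<open>n\<close> a power of two) removes
  such a factor (\<open>norm_le_if_powers_le\<close>). Inside a matrix algebra the factor is a constant; in general it is the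
  number of degrees that occur, since homogeneous components can be cut out by isometries
  (\<open>norm_component_le\<close>).

  The automorphism \<open>\<lambda>\<^sub>A\<close> acts on words as a finite transducer whose state is a window of three letters
  (\<open>encodes_run\<close>), and so does \<open>\<lambda>\<^sub>F \<circ> \<lambda>\<^sub>A\<close>. Comparing words of length six shows that
  \<open>(\<lambda>\<^sub>F \<circ> \<lambda>\<^sub>A)\<^sup>2\<close> is the inner automorphism \<open>Ad v\<close> for an explicit permutation unitary \<open>v\<close> (\<open>FA_square\<close>).
  In particular \<open>\<lambda>\<^sub>A\<close> is bijective.

  On the Cantor space of infinite words, \<open>\<lambda>\<^sub>A\<close> induces a homeomorphism that behaves like a cellular automaton. In
  a background \<open>121212...\<close> the defects \<open>11\<close> and \<open>22\<close> move with different speeds, and the gap between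
  neighbouring defects changes at every step (\<open>moves_block\<close>). An inner automorphism, on the other hand, is
  approximated by finite sums of \<open>S\<^sub>\<gamma> S\<^sub>\<epsilon>\<^sup>*\<close> and hence can only change a bounded number of leading letters
  of a word (\<open>not_inner_if_incomparable\<close>). Therefore no positive power of \<open>\<lambda>\<^sub>A\<close> is inner (\<open>A_power_not_inner\<close>).
\<close>

section \<open>Star-endomorphisms are contractive\<close>

lemma scaleC_zero_left [simp]: "scaleC 0 (x::'a::unital_cstar_algebra) = 0"
  using scaleC_of_real[of 0 x] by simp

lemma scaleC_one [simp]: "scaleC 1 (x::'a::unital_cstar_algebra) = x"
  using scaleC_of_real[of 1 x] by simp

lemma scaleC_zero_right [simp]: "scaleC c (0::'a::unital_cstar_algebra) = 0"
  using scaleC_add_right[of c 0 "0::'a"] by simp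

lemma scaleC_minus_one: "scaleC (-1) (x::'a::unital_cstar_algebra) = - x"
  using scaleC_of_real[of "-1" x] by simp

lemma adj_zero [simp]: "adj (0::'a::unital_cstar_algebra) = 0"
  using adj_add[of 0 "0::'a"] by simp

lemma adj_scaleR: "adj (scaleR r (x::'a::unital_cstar_algebra)) = scaleR r (adj x)"
  by (metis adj_scaleC complex_cnj_complex_of_real scaleC_of_real)

lemma adj_sum: "adj (\<Sum>i\<in>I. f i) = (\<Sum>i\<in>I. adj (f i :: 'a::unital_cstar_algebra))"
  by (induction I rule: infinite_finite_induct) (simp_all add: adj_add)

lemma adj_power: "adj ((x::'a::unital_cstar_algebra) ^ n) = adj x ^ n"
  by (induction n) (simp_all add: adj_mult power_commutes)

lemma scaleC_sum_right:
  "scaleC c (\<Sum>i\<in>I. f i) = (\<Sum>i\<in>I. scaleC c (f i :: 'a::unital_cstar_algebra))"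
  by (induction I rule: infinite_finite_induct) (simp_all add: scaleC_add_right)

lemma norm_adj [simp]: "norm (adj (x::'a::unital_cstar_algebra)) = norm x"
proof -
  have le: "norm y \<le> norm (adj y)" for y :: 'a
  proof (cases "y = 0")
    case False
    have "norm y * norm y = norm (adj y * y)"
      by (simp add: cstar_identity power2_eq_square)
    also have "\<dots> \<le> norm (adj y) * norm y" by (rule norm_mult_ineq)
    finally show ?thesis using False by simp
  qed simp
  from le[of x] le[of "adj x"] show ?thesis by (simp add: adj_adj)
qed

lemma bounded_linear_adj: "bounded_linear (adj :: 'a::unital_cstar_algebra \<Rightarrow> 'a)"
  by (rule bounded_linear_intro[of _ 1]) (simp_all add: adj_add adj_scaleR)

lemma norm_le_one_if_isometry:
  assumes "adj w * w = (1::'a::unital_cstar_algebra)" shows "norm w \<le> 1"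
proof -
  have "(norm w)\<^sup>2 = 1\<^sup>2" using cstar_identity[of w] assms by simp
  then have "norm w = 1" by (rule power2_eq_imp_eq) simp_all
  then show ?thesis by simp
qed

lemma abs_gbinomial_half_le_1: "\<bar>(1/2::real) gchoose n\<bar> \<le> 1"
proof (induction n)
  case (Suc n)
  have "((1/2::real) gchoose Suc n) = (1/2 - real n) / real (Suc n) * ((1/2) gchoose n)"
    using gbinomial_mult_1[of "1/2::real" n] by (simp add: field_simps)
  also have "\<bar>\<dots>\<bar> \<le> 1 * 1"
    unfolding abs_mult by (rule mult_mono) (use Suc in \<open>auto simp: abs_if field_simps\<close>)
  finally show ?case by simp
qed simp

text \<open>
  The binomial series of \<open>(1 - k)\<^bsup>1/2\<^esup>\<close> has coefficients bounded by \<open>1\<close>, so it converges absolutely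
  in any Banach algebra as soon as \<open>\<parallel>k\<parallel> < 1\<close>; Vandermonde's identity says that its square is \<open>1 - k\<close>.
\<close>
lemma sqrt_one_minus:
  fixes k :: "'a::unital_cstar_algebra"
  assumes k: "norm k < 1" "adj k = k"
  obtains b where "adj b = b" "b * b = 1 - k" "\<And>z. z * k = k * z \<Longrightarrow> z * b = b * z"
proof -
  define c where "c n = (-1) ^ n * ((1/2::real) gchoose n)" for n
  define g where "g n = c n *\<^sub>R k ^ n" for n
  have c1: "\<bar>c n\<bar> \<le> 1" for n
    using abs_gbinomial_half_le_1[of n] by (simp add: c_def abs_mult)
  have "norm (g n) \<le> norm k ^ n" for n
  proof -
    have "norm (g n) \<le> 1 * norm k ^ n"
      unfolding g_def norm_scaleR by (rule mult_mono) (use c1 norm_power_ineq in auto)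
    then show ?thesis by simp
  qed
  then have sn: "summable (\<lambda>n. norm (g n))"
    by (intro summable_comparison_test[OF _ summable_geometric[of "norm k"]])
       (use k in auto)
  then have sg: "summable g" by (rule summable_norm_cancel)
  define b where "b = suminf g"
  have conv: "(\<Sum>i\<le>n. c i * c (n - i)) = (if n = 0 then 1 else if n = 1 then -1 else 0)" for n
  proof -
    have "(\<Sum>i\<le>n. c i * c (n - i)) = (\<Sum>i\<le>n. (-1) ^ n * (((1/2) gchoose i) * ((1/2) gchoose (n - i))))"
    proof (rule sum.cong)
      fix i assume "i \<in> {..n}"
      then have "(-1 :: real) ^ n = (-1) ^ i * (-1) ^ (n - i)" by (simp flip: power_add)
      then show "c i * c (n - i) = (-1) ^ n * (((1/2) gchoose i) * ((1/2) gchoose (n - i)))"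
        by (simp add: c_def)
    qed simp
    also have "\<dots> = (-1) ^ n * ((1::real) gchoose n)"
      using gbinomial_Vandermonde[of "1/2::real" "1/2" n]
      by (simp add: sum_distrib_left[symmetric] atMost_atLeast0)
    also have "\<dots> = (-1) ^ n * real (1 choose n)"
      using binomial_gbinomial[of 1 n, where ?'a = real] by simp
    also have "\<dots> = (if n = 0 then 1 else if n = 1 then -1 else 0)"
      by (auto simp: binomial_eq_0)
    finally show ?thesis .
  qed
  have "b * b = 1 - k"
  proof -
    have "(\<lambda>n. \<Sum>i\<le>n. g i * g (n - i)) sums (b * b)"
      unfolding b_def by (rule Cauchy_product_sums[OF sn sn])
    moreover have "(\<Sum>i\<le>n. g i * g (n - i)) = (\<Sum>i\<le>n. c i * c (n - i)) *\<^sub>R k ^ n" for n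
      unfolding scaleR_sum_left
      by (rule sum.cong) (auto simp: g_def simp flip: power_add)
    ultimately have "(\<lambda>n. (if n = 0 then 1 else if n = 1 then -1 else 0) *\<^sub>R k ^ n) sums (b * b)"
      by (simp add: conv)
    moreover have "(\<lambda>n. (if n = 0 then 1 else if n = 1 then -1 else 0) *\<^sub>R k ^ n) sums
        (\<Sum>n\<in>{0,1}. (if n = 0 then 1 else if n = 1 then -1 else 0) *\<^sub>R k ^ n)"
      by (rule sums_finite) auto
    ultimately show ?thesis by (auto dest: sums_unique2)
  qed
  moreover have "adj b = b"
    unfolding b_def bounded_linear.suminf[OF bounded_linear_adj sg]
    by (rule arg_cong[where f = suminf]) (simp add: g_def adj_scaleR adj_power k(2) fun_eq_iff)
  moreover have "z * b = b * z" if z: "z * k = k * z" for z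
  proof -
    have "z * g n = g n * z" for n
      using power_commuting_commutes[OF z[symmetric], of n] by (simp add: g_def)
    then show ?thesis
      unfolding b_def using suminf_mult[OF sg, of z] suminf_mult2[OF sg, of z] by simp
  qed
  ultimately show ?thesis using that by blast
qed

lemma star_endomorphismD:
  assumes "star_endomorphism \<phi>"
  shows star_endo_add: "\<phi> (x + y) = \<phi> x + \<phi> y"
    and star_endo_scaleC: "\<phi> (scaleC c x) = scaleC c (\<phi> x)"
    and star_endo_mult: "\<phi> (x * y) = \<phi> x * \<phi> y"
    and star_endo_adj: "\<phi> (adj x) = adj (\<phi> x)"
    and star_endo_one: "\<phi> 1 = 1"
  using assms by (auto simp: star_endomorphism_def)

lemma star_endo_scaleR: "star_endomorphism \<phi> \<Longrightarrow> \<phi> (scaleR r x) = scaleR r (\<phi> x)"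
  by (metis scaleC_of_real star_endo_scaleC)

lemma star_endo_comp:
  "star_endomorphism \<phi> \<Longrightarrow> star_endomorphism \<psi> \<Longrightarrow> star_endomorphism (\<phi> \<circ> \<psi>)"
  by (simp add: star_endomorphism_def)

text \<open>
  A self-adjoint \<open>h\<close> with \<open>\<parallel>h\<parallel> < 1\<close> is the real part of the unitary \<open>h + \<i> (1 - h\<^sup>2)\<^bsup>1/2\<^esup>\<close>, and unitaries
  are mapped to unitaries. This replaces the usual comparison of spectral radii.
\<close>
lemma star_endo_selfadjoint_le_1:
  assumes \<phi>: "star_endomorphism \<phi>" and h: "adj h = h" "norm h < 1"
  shows "norm (\<phi> h) \<le> 1"
proof -
  have hh: "norm (h * h) < 1"
    using cstar_identity[of h] h by (simp add: power_less_one_iff)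
  obtain b where b: "adj b = b" "b * b = 1 - h * h" "\<And>z. z * (h * h) = (h * h) * z \<Longrightarrow> z * b = b * z"
    using sqrt_one_minus[OF hh] by (metis adj_mult h(1))
  have hb: "h * b = b * h" by (rule b(3)) (simp add: mult.assoc)
  define u where "u = h + scaleC \<i> b"
  have au: "adj u = h + scaleC (-\<i>) b" by (simp add: u_def adj_add adj_scaleC h b)
  have cancel: "scaleC \<i> y + scaleC (-\<i>) y = 0" for y :: 'a
    by (simp flip: scaleC_add_left)
  have "adj u * u = h * h + b * b + (scaleC \<i> (b * h) + scaleC (-\<i>) (b * h))"
    unfolding au
    by (simp add: u_def distrib_left distrib_right scaleC_mult_left scaleC_mult_right scaleC_scaleC
        scaleC_add_right hb)
  then have uu: "adj u * u = 1" by (simp add: b cancel)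
  have "adj (\<phi> u) * \<phi> u = 1"
    using uu \<phi> by (metis star_endo_adj star_endo_mult star_endo_one)
  then have n1: "norm (\<phi> u) \<le> 1" by (rule norm_le_one_if_isometry)
  have "u + adj u = 2 *\<^sub>R h"
    using cancel[of b] unfolding au by (simp add: u_def scaleR_2 add.commute add.left_commute)
  then have "2 *\<^sub>R \<phi> h = \<phi> u + adj (\<phi> u)"
    using \<phi> by (metis star_endo_add star_endo_adj star_endo_scaleR)
  then have "2 * norm (\<phi> h) \<le> norm (\<phi> u) + norm (adj (\<phi> u))"
    by (metis abs_numeral norm_scaleR norm_triangle_ineq)
  then show ?thesis using n1 by simp
qed

text \<open>
  By the C*-identity the self-adjoint element \<open>x\<^sup>* x\<close> controls the norm of \<open>x\<close>; rescaling does the rest.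
\<close>
lemma star_endo_contractive:
  assumes \<phi>: "star_endomorphism \<phi>"
  shows "norm (\<phi> x) \<le> norm x"
proof -
  have 1: "norm (\<phi> y) \<le> 1" if "norm y < 1" for y
  proof -
    have "norm (adj y * y) < 1"
      using that by (simp add: cstar_identity power_less_one_iff)
    then have "norm (\<phi> (adj y * y)) \<le> 1"
      by (intro star_endo_selfadjoint_le_1[OF \<phi>]) (simp_all add: adj_mult adj_adj)
    then have "(norm (\<phi> y))\<^sup>2 \<le> 1"
      using \<phi> by (simp add: star_endo_mult star_endo_adj cstar_identity)
    then show ?thesis by (simp add: power_le_one_iff abs_square_le_1)
  qed
  show ?thesis
  proof (rule field_le_epsilon)
    fix e :: real assume e: "0 < e"
    define r where "r = norm x + e"
    have r: "r > 0" using e by (simp add: r_def add_nonneg_pos)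
    have "norm (\<phi> ((1 / r) *\<^sub>R x)) \<le> 1"
      by (rule 1) (use r e in \<open>simp add: r_def field_simps\<close>)
    then show "norm (\<phi> x) \<le> norm x + e"
      using r \<phi> by (simp add: star_endo_scaleR r_def field_simps)
  qed
qed

lemma star_endo_bounded_linear: "star_endomorphism \<phi> \<Longrightarrow> bounded_linear \<phi>"
  by (rule bounded_linear_intro[of _ 1])
     (simp_all add: star_endo_add star_endo_scaleR star_endo_contractive)

lemma cstar_hull_UNIV_induct:
  assumes "cuntz_O2 S" "cstar_subalgebra B" "S 1 \<in> B" "S 2 \<in> B"
  shows "x \<in> B"
proof -
  have "cstar_subalgebra hull {S 1, S 2} \<subseteq> B"
    using assms by (intro hull_minimal) auto
  then show ?thesis using assms(1) by (auto simp: cuntz_O2_def)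
qed

text \<open>
  Contractivity makes the equalizer of two *-endomorphisms closed, hence a C*-subalgebra; it cannot
  contain the generators without being everything.
\<close>
lemma star_endo_eqI:
  assumes S: "cuntz_O2 S" and \<phi>: "star_endomorphism \<phi>" and \<psi>: "star_endomorphism \<psi>"
    and eq: "\<phi> (S 1) = \<psi> (S 1)" "\<phi> (S 2) = \<psi> (S 2)"
  shows "\<phi> = \<psi>"
proof
  fix x
  have "closed {x. \<phi> x = \<psi> x}"
    using bounded_linear.continuous_on[OF star_endo_bounded_linear[OF \<phi>] continuous_on_id]
      bounded_linear.continuous_on[OF star_endo_bounded_linear[OF \<psi>] continuous_on_id]
    by (rule closed_Collect_eq)
  then have "cstar_subalgebra {x. \<phi> x = \<psi> x}"
    using \<phi> \<psi> by (auto simp: cstar_subalgebra_def star_endomorphism_def)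
  from cstar_hull_UNIV_induct[OF S this] eq show "\<phi> x = \<psi> x" by simp
qed

section \<open>Words in a Cuntz family\<close>

text \<open>
  The Cuntz relations alone: the isometries \<open>u\<^sup>* S\<^sub>i\<close> satisfy them before anything is known about
  what they generate.
\<close>
definition cuntz_family :: "(nat \<Rightarrow> 'a::unital_cstar_algebra) \<Rightarrow> bool" where
  "cuntz_family S \<longleftrightarrow> adj (S 1) * S 1 = 1 \<and> adj (S 2) * S 2 = 1 \<and>
     S 1 * adj (S 1) + S 2 * adj (S 2) = 1"

lemma cuntz_O2_family: "cuntz_O2 S \<Longrightarrow> cuntz_family S"
  by (simp add: cuntz_O2_def cuntz_family_def)

text \<open>
  The two range projections add up to \<open>1\<close>; multiplying this equation from the left by \<open>a\<^sup>*\<close> leaves no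
  room for \<open>a\<^sup>* b b\<^sup>*\<close>.
\<close>
lemma cuntz_orth_aux:
  fixes a b :: "'a::unital_cstar_algebra"
  assumes "adj a * a = 1" "adj b * b = 1" "a * adj a + b * adj b = 1"
  shows "adj a * b = 0"
proof -
  have "adj a = adj a * (a * adj a + b * adj b)" using assms by simp
  also have "\<dots> = adj a + adj a * b * adj b"
    using assms(1) by (simp add: distrib_left mult.assoc[symmetric])
  finally have "adj a * b * adj b = 0" by simp
  then have "adj a * b * (adj b * b) = 0" by (simp add: mult.assoc[symmetric])
  then show ?thesis using assms(2) by simp
qed

lemma cuntz_family_orth:
  assumes "cuntz_family S" "i \<in> {1,2}" "j \<in> {1,2}"
  shows "adj (S i) * S j = (if i = j then 1 else 0)"
  using assms cuntz_orth_aux[of "S 1" "S 2"] cuntz_orth_aux[of "S 2" "S 1"]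
  by (auto simp: cuntz_family_def add.commute)

lemma S_word_Nil [simp]: "S_word S [] = 1"
  and S_word_Cons [simp]: "S_word S (i # \<alpha>) = S i * S_word S \<alpha>"
  and S_word_append: "S_word S (\<alpha> @ \<beta>) = S_word S \<alpha> * S_word S \<beta>"
  by (simp_all add: S_word_def)

lemma words_0 [simp]: "words 0 = {[]}"
  by (auto simp: words_def)

lemma finite_words [simp]: "finite (words k)"
  using finite_lists_length_eq[of "{1,2::nat}" k] by (simp add: words_def conj_commute)

lemma words_Suc: "words (Suc k) = (#) 1 ` words k \<union> (#) 2 ` words k"
  by (auto simp: words_def length_Suc_conv)

lemma words_append: "\<alpha> \<in> words a \<Longrightarrow> \<beta> \<in> words b \<Longrightarrow> \<alpha> @ \<beta> \<in> words (a + b)"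
  by (auto simp: words_def)

lemma words_split:
  assumes "\<alpha> \<in> words (a + b)"
  obtains \<beta> \<gamma> where "\<alpha> = \<beta> @ \<gamma>" "\<beta> \<in> words a" "\<gamma> \<in> words b"
proof (rule that)
  show "\<alpha> = take a \<alpha> @ drop a \<alpha>" by simp
qed (use assms in \<open>auto simp: words_def dest: in_set_takeD in_set_dropD\<close>)

lemma sum_words_Suc:
  fixes f :: "nat list \<Rightarrow> 'a::comm_monoid_add"
  shows "(\<Sum>\<alpha>\<in>words (Suc k). f \<alpha>) = (\<Sum>\<alpha>\<in>words k. f (1 # \<alpha>)) + (\<Sum>\<alpha>\<in>words k. f (2 # \<alpha>))"
  unfolding words_Suc by (subst sum.union_disjoint) (auto simp: sum.reindex)

lemma S_word_resolution:
  assumes "cuntz_family S"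
  shows "(\<Sum>\<alpha>\<in>words k. S_word S \<alpha> * adj (S_word S \<alpha>)) = 1"
proof (induction k)
  case (Suc k)
  have "(\<Sum>\<alpha>\<in>words k. S_word S (i # \<alpha>) * adj (S_word S (i # \<alpha>))) = S i * adj (S i)" for i
  proof -
    have "(\<Sum>\<alpha>\<in>words k. S_word S (i # \<alpha>) * adj (S_word S (i # \<alpha>)))
        = S i * (\<Sum>\<alpha>\<in>words k. S_word S \<alpha> * adj (S_word S \<alpha>)) * adj (S i)"
      by (simp add: sum_distrib_left sum_distrib_right adj_mult mult.assoc)
    then show ?thesis by (simp add: Suc)
  qed
  then show ?case using assms by (simp only: sum_words_Suc) (simp add: cuntz_family_def)
qed simp

lemma S_word_isometry:
  assumes "cuntz_family S" "set \<alpha> \<subseteq> {1,2}"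
  shows "adj (S_word S \<alpha>) * S_word S \<alpha> = 1"
  using assms(2)
proof (induction \<alpha>)
  case (Cons i \<alpha>)
  have "adj (S_word S (i # \<alpha>)) * S_word S (i # \<alpha>)
      = adj (S_word S \<alpha>) * (adj (S i) * S i) * S_word S \<alpha>"
    by (simp add: adj_mult mult.assoc)
  then show ?case using Cons cuntz_family_orth[OF assms(1), of i i] by simp
qed simp

lemma S_word_orth:
  assumes "cuntz_family S" "\<alpha> \<in> words k" "\<beta> \<in> words k"
  shows "adj (S_word S \<alpha>) * S_word S \<beta> = (if \<alpha> = \<beta> then 1 else 0)"
  using assms(2,3)
proof (induction k arbitrary: \<alpha> \<beta>)
  case (Suc k)
  then obtain i j \<alpha>' \<beta>' where e: "\<alpha> = i # \<alpha>'" "\<beta> = j # \<beta>'" "i \<in> {1,2}" "j \<in> {1,2}"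
     "\<alpha>' \<in> words k" "\<beta>' \<in> words k"
    by (auto simp: words_Suc)
  have "adj (S_word S \<alpha>) * S_word S \<beta> = adj (S_word S \<alpha>') * (adj (S i) * S j) * S_word S \<beta>'"
    by (simp add: e adj_mult mult.assoc)
  also have "\<dots> = (if i = j then adj (S_word S \<alpha>') * S_word S \<beta>' else 0)"
    by (simp add: cuntz_family_orth[OF assms(1) e(3,4)])
  also have "\<dots> = (if \<alpha> = \<beta> then 1 else 0)"
    by (subst Suc.IH[OF e(5,6)]) (simp add: e(1,2))
  finally show ?case .
qed simp

lemma S_word_norm_le:
  assumes "cuntz_family S" "set \<alpha> \<subseteq> {1,2}"
  shows "norm (S_word S \<alpha>) \<le> 1"
  by (rule norm_le_one_if_isometry) (rule S_word_isometry[OF assms])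

text \<open>
  Elements are compared throughout by their action on the words of one fixed length, which turns
  identities in the algebra into computations with words.
\<close>
lemma eq_if_eq_on_words:
  assumes S: "cuntz_family S" and eq: "\<And>\<alpha>. \<alpha> \<in> words k \<Longrightarrow> x * S_word S \<alpha> = y * S_word S \<alpha>"
  shows "x = y"
proof -
  have "x = (\<Sum>\<alpha>\<in>words k. x * S_word S \<alpha> * adj (S_word S \<alpha>))"
    by (simp add: mult.assoc S_word_resolution[OF S] flip: sum_distrib_left)
  also have "\<dots> = (\<Sum>\<alpha>\<in>words k. y * S_word S \<alpha> * adj (S_word S \<alpha>))"
    by (simp add: eq)
  also have "\<dots> = y"
    by (simp add: mult.assoc S_word_resolution[OF S] flip: sum_distrib_left)
  finally show ?thesis .
qed

section \<open>Cuntz's uniqueness theorem\<close>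

text \<open>
  \<open>corr S T a b x y\<close> says that \<open>x = \<Sum> c(\<alpha>,\<beta>) S\<^sub>\<alpha> S\<^sub>\<beta>\<^sup>*\<close> and \<open>y = \<Sum> c(\<alpha>,\<beta>) T\<^sub>\<alpha> T\<^sub>\<beta>\<^sup>*\<close> with the same scalars
  \<open>c(\<alpha>,\<beta>)\<close>, where \<open>\<alpha>\<close> and \<open>\<beta>\<close> run through the words of length \<open>a\<close> and \<open>b\<close>. Expressing this through matrix
  coefficients avoids formal sums: elements related to each other are the values of one *-polynomial
  at the two families. The aim is to show that such values have the same norm.
\<close>
definition corr :: "(nat \<Rightarrow> 'a::unital_cstar_algebra) \<Rightarrow> (nat \<Rightarrow> 'a) \<Rightarrow> nat \<Rightarrow> nat \<Rightarrow> 'a \<Rightarrow> 'a \<Rightarrow> bool"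
where
  "corr S T a b x y \<longleftrightarrow> (\<forall>\<alpha>\<in>words a. \<forall>\<beta>\<in>words b. \<exists>c.
     adj (S_word S \<alpha>) * x * S_word S \<beta> = scaleC c 1 \<and> adj (S_word T \<alpha>) * y * S_word T \<beta> = scaleC c 1)"

lemma corr_one: "corr S T 0 0 1 1"
  by (auto simp: corr_def intro: exI[of _ 1])

lemma corr_zero: "corr S T a b 0 0"
  by (auto simp: corr_def intro: exI[of _ 0])

lemma corr_add: "corr S T a b x y \<Longrightarrow> corr S T a b x' y' \<Longrightarrow> corr S T a b (x + x') (y + y')"
  unfolding corr_def by (simp add: distrib_left distrib_right) (metis scaleC_add_left)

lemma corr_scaleC: "corr S T a b x y \<Longrightarrow> corr S T a b (scaleC c x) (scaleC c y)"
  unfolding corr_def by (simp add: scaleC_mult_left scaleC_mult_right) (metis scaleC_scaleC)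

lemma corr_adj:
  assumes "corr S T a b x y" shows "corr S T b a (adj x) (adj y)"
  unfolding corr_def
proof (intro ballI)
  fix \<alpha> \<beta> assume "\<alpha> \<in> words b" "\<beta> \<in> words a"
  with assms obtain c where c:
    "adj (S_word S \<beta>) * x * S_word S \<alpha> = scaleC c 1" "adj (S_word T \<beta>) * y * S_word T \<alpha> = scaleC c 1"
    unfolding corr_def by blast
  show "\<exists>c. adj (S_word S \<alpha>) * adj x * S_word S \<beta> = scaleC c 1 \<and>
      adj (S_word T \<alpha>) * adj y * S_word T \<beta> = scaleC c 1"
    using arg_cong[OF c(1), of adj] arg_cong[OF c(2), of adj]
    by (intro exI[of _ "cnj c"]) (simp add: adj_mult adj_adj adj_scaleC mult.assoc)
qed

lemma scaleC_sum_left: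
  "scaleC (\<Sum>i\<in>I. c i) (x::'a::unital_cstar_algebra) = (\<Sum>i\<in>I. scaleC (c i) x)"
  by (induction I rule: infinite_finite_induct) (simp_all add: scaleC_add_left)

context
  fixes S T :: "nat \<Rightarrow> 'a::unital_cstar_algebra"
  assumes S: "cuntz_family S" and T: "cuntz_family T"
begin

lemma corr_mult:
  assumes 1: "corr S T a b x y" and 2: "corr S T b d x' y'"
  shows "corr S T a d (x * x') (y * y')"
  unfolding corr_def
proof (intro ballI)
  fix \<alpha> \<delta> assume a: "\<alpha> \<in> words a" "\<delta> \<in> words d"
  have "\<forall>\<beta>\<in>words b. \<exists>c. adj (S_word S \<alpha>) * x * S_word S \<beta> = scaleC c 1 \<and>
      adj (S_word T \<alpha>) * y * S_word T \<beta> = scaleC c 1"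
    using 1 a by (auto simp: corr_def)
  then obtain c where c: "\<And>\<beta>. \<beta> \<in> words b \<Longrightarrow> adj (S_word S \<alpha>) * x * S_word S \<beta> = scaleC (c \<beta>) 1"
      "\<And>\<beta>. \<beta> \<in> words b \<Longrightarrow> adj (S_word T \<alpha>) * y * S_word T \<beta> = scaleC (c \<beta>) 1" by metis
  have "\<forall>\<beta>\<in>words b. \<exists>c. adj (S_word S \<beta>) * x' * S_word S \<delta> = scaleC c 1 \<and>
      adj (S_word T \<beta>) * y' * S_word T \<delta> = scaleC c 1"
    using 2 a by (auto simp: corr_def)
  then obtain e where e: "\<And>\<beta>. \<beta> \<in> words b \<Longrightarrow> adj (S_word S \<beta>) * x' * S_word S \<delta> = scaleC (e \<beta>) 1"
      "\<And>\<beta>. \<beta> \<in> words b \<Longrightarrow> adj (S_word T \<beta>) * y' * S_word T \<delta> = scaleC (e \<beta>) 1" by metis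
  have eq: "adj (S_word U \<alpha>) * (z * z') * S_word U \<delta> = scaleC (\<Sum>\<beta>\<in>words b. c \<beta> * e \<beta>) 1"
    if U: "cuntz_family U"
      and *: "\<And>\<beta>. \<beta> \<in> words b \<Longrightarrow> adj (S_word U \<alpha>) * z * S_word U \<beta> = scaleC (c \<beta>) 1"
        "\<And>\<beta>. \<beta> \<in> words b \<Longrightarrow> adj (S_word U \<beta>) * z' * S_word U \<delta> = scaleC (e \<beta>) 1"
    for U :: "nat \<Rightarrow> 'a" and z z'
  proof -
    have "adj (S_word U \<alpha>) * (z * z') * S_word U \<delta>
        = adj (S_word U \<alpha>) * z * (\<Sum>\<beta>\<in>words b. S_word U \<beta> * adj (S_word U \<beta>)) * z' * S_word U \<delta>"
      by (simp add: S_word_resolution[OF U] mult.assoc)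
    also have "\<dots> = (\<Sum>\<beta>\<in>words b. (adj (S_word U \<alpha>) * z * S_word U \<beta>) * (adj (S_word U \<beta>) * z' * S_word U \<delta>))"
      by (simp add: sum_distrib_left sum_distrib_right mult.assoc)
    also have "\<dots> = (\<Sum>\<beta>\<in>words b. scaleC (c \<beta> * e \<beta>) 1)"
      by (rule sum.cong) (simp_all add: * scaleC_mult_left scaleC_scaleC)
    finally show ?thesis by (simp add: scaleC_sum_left)
  qed
  show "\<exists>c. adj (S_word S \<alpha>) * (x * x') * S_word S \<delta> = scaleC c 1 \<and>
      adj (S_word T \<alpha>) * (y * y') * S_word T \<delta> = scaleC c 1"
    using eq[OF S c(1) e(1)] eq[OF T c(2) e(2)] by blast
qed

text \<open>
  Any \<open>S\<^sub>\<alpha> S\<^sub>\<beta>\<^sup>*\<close> is the sum of the \<open>S\<^sub>\<alpha>\<^sub>\<gamma> S\<^sub>\<beta>\<^sub>\<gamma>\<^sup>*\<close> over the words \<open>\<gamma>\<close> of length \<open>n\<close>, so only the difference of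
  the lengths is intrinsic. This is what allows sums and products of elements of different shapes.
\<close>
lemma corr_raise:
  assumes 1: "corr S T a b x y"
  shows "corr S T (a + n) (b + n) x y"
  unfolding corr_def
proof (intro ballI)
  fix \<alpha> \<beta> assume "\<alpha> \<in> words (a + n)" "\<beta> \<in> words (b + n)"
  then obtain \<alpha>1 \<alpha>2 \<beta>1 \<beta>2 where d: "\<alpha> = \<alpha>1 @ \<alpha>2" "\<alpha>1 \<in> words a" "\<alpha>2 \<in> words n"
      "\<beta> = \<beta>1 @ \<beta>2" "\<beta>1 \<in> words b" "\<beta>2 \<in> words n"
    by (elim words_split) metis
  then obtain c where c: "adj (S_word S \<alpha>1) * x * S_word S \<beta>1 = scaleC c 1"
      "adj (S_word T \<alpha>1) * y * S_word T \<beta>1 = scaleC c 1"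
    using 1 unfolding corr_def by blast
  have eq: "adj (S_word U \<alpha>) * z * S_word U \<beta> = scaleC (if \<alpha>2 = \<beta>2 then c else 0) 1"
    if U: "cuntz_family U" and c: "adj (S_word U \<alpha>1) * z * S_word U \<beta>1 = scaleC c 1"
    for U :: "nat \<Rightarrow> 'a" and z
  proof -
    have "adj (S_word U \<alpha>) * z * S_word U \<beta>
        = adj (S_word U \<alpha>2) * (adj (S_word U \<alpha>1) * z * S_word U \<beta>1) * S_word U \<beta>2"
      by (simp add: d S_word_append adj_mult mult.assoc)
    also have "\<dots> = scaleC c (adj (S_word U \<alpha>2) * S_word U \<beta>2)"
      by (simp add: c scaleC_mult_left scaleC_mult_right)
    finally show ?thesis by (simp add: S_word_orth[OF U d(3,6)])
  qed
  show "\<exists>c. adj (S_word S \<alpha>) * x * S_word S \<beta> = scaleC c 1 \<and>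
      adj (S_word T \<alpha>) * y * S_word T \<beta> = scaleC c 1"
    using eq[OF S c(1)] eq[OF T c(2)] by blast
qed

lemma corr_gen: "i \<in> {1,2} \<Longrightarrow> corr S T 1 0 (S i) (T i)"
  unfolding corr_def
proof (intro ballI)
  fix \<alpha> \<beta> assume i: "i \<in> {1,2}" and "\<alpha> \<in> words 1" "\<beta> \<in> words 0"
  then obtain j where j: "\<alpha> = [j]" "j \<in> {1,2}" "\<beta> = []"
    by (auto simp: words_Suc)
  show "\<exists>c. adj (S_word S \<alpha>) * S i * S_word S \<beta> = scaleC c 1 \<and>
      adj (S_word T \<alpha>) * T i * S_word T \<beta> = scaleC c 1"
    using cuntz_family_orth[OF S j(2) i] cuntz_family_orth[OF T j(2) i]
    by (intro exI[of _ "if j = i then 1 else 0"]) (simp add: j)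
qed

lemma card_words: "card (words k) = 2 ^ k"
proof (induction k)
  case (Suc k)
  have "card (words (Suc k)) = card ((#) (1::nat) ` words k) + card ((#) (2::nat) ` words k)"
    unfolding words_Suc by (rule card_Un_disjoint) auto
  then show ?case by (simp add: card_image Suc)
qed simp

text \<open>
  A crude bound: there are \<open>4\<^sup>k\<close> coefficients, each bounded by \<open>\<parallel>x\<parallel>\<close>. The constant is harmless, because it is
  the same for all powers of \<open>x\<^sup>* x\<close>.
\<close>
lemma corr_bounded:
  assumes 1: "corr S T k k x y"
  shows "norm y \<le> 4 ^ k * norm x"
proof -
  have y: "y = (\<Sum>\<alpha>\<in>words k. \<Sum>\<beta>\<in>words k. S_word T \<alpha> * (adj (S_word T \<alpha>) * y * S_word T \<beta>) * adj (S_word T \<beta>))"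
  proof -
    have "y = (\<Sum>\<alpha>\<in>words k. S_word T \<alpha> * adj (S_word T \<alpha>)) * y * (\<Sum>\<alpha>\<in>words k. S_word T \<alpha> * adj (S_word T \<alpha>))"
      by (simp add: S_word_resolution[OF T])
    then show ?thesis by (simp only: sum_distrib_left sum_distrib_right mult.assoc) (subst sum.swap, simp)
  qed
  have nw: "norm (S_word U \<alpha>) \<le> 1" if "cuntz_family U" "\<alpha> \<in> words k" for U :: "nat \<Rightarrow> 'a" and \<alpha>
    by (rule S_word_norm_le) (use that in \<open>auto simp: words_def\<close>)
  have le: "norm (adj a * b * c) \<le> norm b" if "norm a \<le> 1" "norm c \<le> 1" for a b c :: 'a
  proof -
    have "norm (adj a * b * c) \<le> norm (adj a) * norm b * norm c"
      by (meson norm_mult_ineq mult_right_mono norm_ge_zero order_trans)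
    also have "\<dots> \<le> 1 * norm b * 1"
      by (intro mult_mono) (use that in auto)
    finally show ?thesis by simp
  qed
  have "norm (S_word T \<alpha> * (adj (S_word T \<alpha>) * y * S_word T \<beta>) * adj (S_word T \<beta>)) \<le> norm x"
    if a: "\<alpha> \<in> words k" "\<beta> \<in> words k" for \<alpha> \<beta>
  proof -
    obtain c where c: "adj (S_word S \<alpha>) * x * S_word S \<beta> = scaleC c 1"
      "adj (S_word T \<alpha>) * y * S_word T \<beta> = scaleC c 1"
      using 1 a unfolding corr_def by blast
    have "norm (S_word T \<alpha> * scaleC c 1 * adj (S_word T \<beta>)) \<le> norm (scaleC c (1::'a))"
      using le[of "adj (S_word T \<alpha>)" "adj (S_word T \<beta>)" "scaleC c 1"] nw[OF T] a by (simp add: adj_adj)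
    also have "\<dots> = norm (adj (S_word S \<alpha>) * x * S_word S \<beta>)" by (simp add: c)
    also have "\<dots> \<le> norm x" using nw[OF S] a by (intro le)
    finally show ?thesis by (simp add: c)
  qed
  then have "norm y \<le> (\<Sum>\<alpha>\<in>words k. \<Sum>\<beta>\<in>words k. norm x)"
    by (subst y) (intro order_trans[OF norm_sum] sum_mono order_trans[OF norm_sum] | simp)+
  then show ?thesis
    by (simp add: card_words power_mult_distrib[symmetric] flip: mult.assoc)
qed

end

lemma norm_selfadjoint_power:
  fixes h :: "'a::unital_cstar_algebra"
  assumes "adj h = h"
  shows "norm (h ^ (2 ^ n)) = norm h ^ (2 ^ n)"
proof (induction n)
  case (Suc n)
  have "h ^ (2 ^ Suc n) = adj (h ^ (2 ^ n)) * h ^ (2 ^ n)"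
    by (simp add: adj_power assms mult_2 power_add)
  then have "norm (h ^ (2 ^ Suc n)) = (norm (h ^ (2 ^ n)))\<^sup>2"
    by (simp only: cstar_identity)
  then show ?case by (simp add: Suc power_mult[symmetric] mult.commute)
qed simp

text \<open>
  In a C*-algebra the norm of \<open>x\<close> can be read off from the powers of \<open>x\<^sup>* x\<close>, and linear factors
  disappear when roots of high order are taken.
\<close>
lemma norm_le_if_powers_le:
  fixes x y :: "'a::unital_cstar_algebra"
  assumes le: "\<And>n. norm ((adj y * y) ^ n) \<le> (C * real n + D) * norm ((adj x * x) ^ n)"
    and C: "C \<ge> 0" "D \<ge> 0"
  shows "norm y \<le> norm x"
proof (rule ccontr)
  assume "\<not> norm y \<le> norm x"
  then have lt: "norm x < norm y" by simp
  have C0: "norm y ^ (2 * 2 ^ n) \<le> (C * 2 ^ n + D) * norm x ^ (2 * 2 ^ n)" for n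
  proof -
    have n: "norm ((adj z * z) ^ (2 ^ n)) = norm z ^ (2 * 2 ^ n)" for z :: 'a
      by (subst norm_selfadjoint_power) (simp_all add: adj_mult adj_adj cstar_identity power_mult)
    show ?thesis using le[of "2 ^ n"] by (simp add: n)
  qed
  have x: "norm x > 0"
  proof (rule ccontr)
    assume "\<not> norm x > 0"
    then have "norm x = 0" by simp
    with C0[of 0] lt show False by simp
  qed
  define r where "r = (norm y / norm x)\<^sup>2"
  have r: "r > 1" unfolding r_def using lt x by (intro one_less_power) simp_all
  have *: "r ^ (2 ^ n) \<le> C * 2 ^ n + D" for n
  proof -
    have "r ^ (2 ^ n) = norm y ^ (2 * 2 ^ n) / norm x ^ (2 * 2 ^ n)"
      by (simp add: r_def power_divide power_mult[symmetric])
    also have "\<dots> \<le> C * 2 ^ n + D" using C0[of n] x by (simp add: divide_le_eq)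
    finally show ?thesis .
  qed
  define s where "s = r - 1"
  have s: "s > 0" using r by (simp add: s_def)
  have sq: "(1 + real m * s)\<^sup>2 \<le> r ^ (2 * m)" for m
  proof -
    have "1 + real m * s \<le> r ^ m"
      using Bernoulli_inequality[of s m] s by (simp add: s_def)
    then have "(1 + real m * s)\<^sup>2 \<le> (r ^ m)\<^sup>2"
      using s by (intro power_mono) auto
    then show ?thesis by (simp add: power_mult[symmetric] mult.commute)
  qed
  \<comment> \<open>The squared Bernoulli inequality \<open>sq\<close> is quadratic in the exponent and beats the linear bound.\<close>
  obtain n :: nat where n: "real n > (2 * C + D) / (s * s)" using reals_Archimedean2 by blast
  define m :: real where "m = 2 ^ n"
  have m: "m > (2 * C + D) / (s * s)" "m \<ge> 1"
    using n less_exp[of n] unfolding m_def by (auto intro: order_less_trans simp flip: of_nat_less_iff)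
  have "(1 + m * s)\<^sup>2 \<le> C * (2 * m) + D"
    using sq[of "2 ^ n"] *[of "Suc n"] by (simp add: m_def)
  also have "\<dots> \<le> (2 * C + D) * m"
    using m(2) C mult_left_mono[of 1 m D] by (simp add: algebra_simps)
  finally have 1: "(1 + m * s)\<^sup>2 \<le> (2 * C + D) * m" .
  have "(m * s)\<^sup>2 \<le> (1 + m * s)\<^sup>2"
    using m s by (intro power_mono) auto
  with 1 have "m * (m * (s * s)) \<le> m * (2 * C + D)"
    by (simp add: power2_eq_square algebra_simps)
  then have "m * (s * s) \<le> 2 * C + D" using m(2) by simp
  moreover have "2 * C + D < m * (s * s)" using m(1) s by (simp add: pos_divide_less_eq)
  ultimately show False by simp
qed

subsection \<open>The grading by degree\<close>

definition homogeneous :: "(nat \<Rightarrow> 'a::unital_cstar_algebra) \<Rightarrow> (nat \<Rightarrow> 'a) \<Rightarrow> int \<Rightarrow> 'a \<Rightarrow> 'a \<Rightarrow> bool" where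
  "homogeneous S T j x y \<longleftrightarrow> (\<exists>a b. int a - int b = j \<and> corr S T a b x y)"

definition graded :: "(nat \<Rightarrow> 'a::unital_cstar_algebra) \<Rightarrow> (nat \<Rightarrow> 'a) \<Rightarrow> nat \<Rightarrow> 'a \<Rightarrow> 'a \<Rightarrow> bool" where
  "graded S T m x y \<longleftrightarrow> (\<exists>q r. (\<forall>j\<in>{- int m..int m}. homogeneous S T j (q j) (r j)) \<and>
      x = (\<Sum>j\<in>{- int m..int m}. q j) \<and> y = (\<Sum>j\<in>{- int m..int m}. r j))"

lemma homogeneous_zero: "homogeneous S T j 0 0"
  unfolding homogeneous_def by (intro exI[of _ "nat j"] exI[of _ "nat (- j)"]) (simp add: corr_zero)

lemma homogeneous_scaleC: "homogeneous S T j x y \<Longrightarrow> homogeneous S T j (scaleC c x) (scaleC c y)"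
  unfolding homogeneous_def using corr_scaleC by blast

lemma homogeneous_adj: "homogeneous S T j x y \<Longrightarrow> homogeneous S T (- j) (adj x) (adj y)"
  unfolding homogeneous_def using corr_adj by (metis minus_diff_eq)

context
  fixes S T :: "nat \<Rightarrow> 'a::unital_cstar_algebra"
  assumes S: "cuntz_family S" and T: "cuntz_family T"
begin

lemma homogeneous_add:
  assumes "homogeneous S T j x y" "homogeneous S T j x' y'"
  shows "homogeneous S T j (x + x') (y + y')"
proof -
  obtain a b a' b' where ab: "int a - int b = j" "corr S T a b x y"
      "int a' - int b' = j" "corr S T a' b' x' y'"
    using assms unfolding homogeneous_def by blast
  have "b + a' = b' + a" using ab by linarith
  then have "corr S T (a + a') (b + a') (x + x') (y + y')"
    using corr_raise[OF S T ab(2), of a'] corr_raise[OF S T ab(4), of a]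
    by (intro corr_add) (simp_all add: add.commute)
  then show ?thesis unfolding homogeneous_def using ab
    by (intro exI[of _ "a + a'"] exI[of _ "b + a'"]) simp
qed

lemma homogeneous_mult:
  assumes "homogeneous S T i x y" "homogeneous S T j x' y'"
  shows "homogeneous S T (i + j) (x * x') (y * y')"
proof -
  obtain a b a' b' where ab: "int a - int b = i" "corr S T a b x y"
      "int a' - int b' = j" "corr S T a' b' x' y'"
    using assms unfolding homogeneous_def by blast
  have "corr S T (a + a') (b' + b) (x * x') (y * y')"
    by (rule corr_mult[OF S T corr_raise[OF S T ab(2), of a']])
       (use corr_raise[OF S T ab(4), of b] in \<open>simp add: add.commute\<close>)
  then show ?thesis unfolding homogeneous_def using ab
    by (intro exI[of _ "a + a'"] exI[of _ "b' + b"]) simp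
qed

lemma corr_power:
  assumes "corr S T k k x y" shows "corr S T k k (x ^ n) (y ^ n)"
proof (induction n)
  case 0
  show ?case using corr_raise[OF S T corr_one, of k] by simp
qed (use assms in \<open>simp add: corr_mult[OF S T]\<close>)

text \<open>
  The powers of \<open>x\<^sup>* x\<close> remain in the matrix algebra spanned by the \<open>S\<^sub>\<alpha> S\<^sub>\<beta>\<^sup>*\<close> with \<open>\<bar>\<alpha>\<bar> = \<bar>\<beta>\<bar> = b\<close>, so that they
  satisfy the crude bound with one constant, which the C*-identity then removes.
\<close>
lemma homogeneous_norm_le:
  assumes "homogeneous S T j x y" shows "norm y \<le> norm x"
proof -
  obtain a b where "corr S T a b x y" using assms unfolding homogeneous_def by blast
  then have "corr S T b b (adj x * x) (adj y * y)"
    by (intro corr_mult[OF S T] corr_adj)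
  then have "norm ((adj y * y) ^ n) \<le> 4 ^ b * norm ((adj x * x) ^ n)" for n
    by (intro corr_bounded[OF S T] corr_power)
  then show ?thesis
    by (intro norm_le_if_powers_le[of y 0 "4 ^ b" x]) simp_all
qed

lemma S_word_replicate: "S_word U (replicate n i) = U i ^ n"
  by (induction n) simp_all

text \<open>
  A shift by at least \<open>1\<close> and at most \<open>m\<close> letters cannot map the word \<open>1\<^sup>m 2\<close> to a word comparable with it:
  the final \<open>2\<close> would meet a \<open>1\<close>.
\<close>
lemma gap_annihilates:
  assumes "\<mu> \<in> words l" "1 \<le> l" "l \<le> m"
  shows "adj (S 1 ^ m * S 2) * S_word S \<mu> * (S 1 ^ m * S 2) = 0"
proof -
  let ?p = "S 1"
  have iso: "adj (?p ^ n) * ?p ^ n = 1" for n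
    using S_word_isometry[OF S, of "replicate n 1"]
    by (simp add: S_word_replicate set_replicate_conv_if)
  have split: "?p ^ m = ?p ^ l * ?p ^ (m - l)" "?p ^ m = ?p ^ (m - l) * ?p ^ l"
    using assms by (simp_all flip: power_add)
  have orth: "adj (?p ^ l) * S_word S \<mu> = (if replicate l 1 = \<mu> then 1 else 0)"
    using S_word_orth[OF S _ assms(1), of "replicate l 1"] by (simp add: S_word_replicate words_def set_replicate_conv_if)
  have "adj (S 2) * ?p ^ l * S 2 = 0"
  proof -
    have "?p ^ l = ?p * ?p ^ (l - 1)" using assms by (simp flip: power_Suc)
    then have "adj (S 2) * ?p ^ l * S 2 = adj (S 2) * ?p * ?p ^ (l - 1) * S 2"
      by (simp add: mult.assoc)
    then show ?thesis using cuntz_family_orth[OF S, of 2 1] by simp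
  qed
  then have 0: "adj (S 2) * (?p ^ l * S 2) = 0" by (simp add: mult.assoc)
  have "adj (?p ^ m * S 2) * S_word S \<mu> * (?p ^ m * S 2)
     = adj (S 2) * adj (?p ^ (m - l)) * (adj (?p ^ l) * S_word S \<mu>) * (?p ^ (m - l) * ?p ^ l * S 2)"
    using split by (metis (no_types, lifting) adj_mult mult.assoc)
  also have "\<dots> = 0"
  proof (cases "replicate l 1 = \<mu>")
    case True
    then have "adj (S 2) * adj (?p ^ (m - l)) * (adj (?p ^ l) * S_word S \<mu>) * (?p ^ (m - l) * ?p ^ l * S 2)
      = adj (S 2) * (adj (?p ^ (m - l)) * ?p ^ (m - l)) * (?p ^ l * S 2)"
      using orth by (simp add: mult.assoc)
    also have "\<dots> = adj (S 2) * (?p ^ l * S 2)" by (simp only: iso mult_1_right)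
    finally show ?thesis using 0 by (rule trans)
  next
    case False
    show ?thesis by (simp only: orth False if_False mult_zero_left mult_zero_right)
  qed
  finally show ?thesis .
qed

lemma corr_off_degree:
  assumes c: "corr S T (a + l) b x y" and w: "\<gamma> \<in> words a" "\<delta> \<in> words b" and l: "1 \<le> l" "l \<le> m"
  shows "adj (S 1 ^ m * S 2) * (adj (S_word S \<gamma>) * x * S_word S \<delta>) * (S 1 ^ m * S 2) = 0"
proof -
  let ?v = "S 1 ^ m * S 2"
  have "adj (S_word S \<gamma>) * x * S_word S \<delta>
      = (\<Sum>\<mu>\<in>words l. S_word S \<mu> * adj (S_word S \<mu>)) * (adj (S_word S \<gamma>) * x * S_word S \<delta>)"
    by (simp add: S_word_resolution[OF S])
  then have e: "adj (S_word S \<gamma>) * x * S_word S \<delta>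
      = (\<Sum>\<mu>\<in>words l. S_word S \<mu> * (adj (S_word S (\<gamma> @ \<mu>)) * x * S_word S \<delta>))"
    by (simp add: sum_distrib_right S_word_append adj_mult mult.assoc)
  have 0: "adj ?v * (S_word S \<mu> * (adj (S_word S (\<gamma> @ \<mu>)) * x * S_word S \<delta>)) * ?v = 0"
    if \<mu>: "\<mu> \<in> words l" for \<mu>
  proof -
    obtain d where d: "adj (S_word S (\<gamma> @ \<mu>)) * x * S_word S \<delta> = scaleC d 1"
      using c words_append[OF w(1) \<mu>] w(2) unfolding corr_def by blast
    have "adj ?v * (S_word S \<mu> * scaleC d 1) * ?v = scaleC d (adj ?v * S_word S \<mu> * ?v)"
      by (simp add: scaleC_mult_left scaleC_mult_right)
    then show ?thesis by (simp only: d gap_annihilates[OF \<mu> l] scaleC_zero_right)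
  qed
  show ?thesis
    unfolding e sum_distrib_left sum_distrib_right by (rule sum.neutral) (use 0 in blast)
qed

lemma corr_off_degree':
  assumes c: "corr S T a (b + l) x y" and w: "\<gamma> \<in> words a" "\<delta> \<in> words b" and l: "1 \<le> l" "l \<le> m"
  shows "adj (S 1 ^ m * S 2) * (adj (S_word S \<gamma>) * x * S_word S \<delta>) * (S 1 ^ m * S 2) = 0"
proof -
  have "adj (adj (S 1 ^ m * S 2) * (adj (S_word S \<gamma>) * x * S_word S \<delta>) * (S 1 ^ m * S 2))
     = adj (S 1 ^ m * S 2) * (adj (S_word S \<delta>) * adj x * S_word S \<gamma>) * (S 1 ^ m * S 2)"
    by (simp add: adj_mult adj_adj mult.assoc)
  also have "\<dots> = 0" by (rule corr_off_degree[OF corr_adj[OF c] w(2,1) l])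
  finally show ?thesis by (metis adj_adj adj_zero)
qed

text \<open>
  With \<open>v = S\<^sub>1\<^sup>m S\<^sub>2\<close>, this isometry inserts \<open>v\<close> after the first \<open>n\<close> letters of a word. Compressing an element
  by \<open>spread m a\<close> and \<open>spread m b\<close>, for large \<open>a\<close> and \<open>b\<close>, keeps its part of degree \<open>a - b\<close> and annihilates every other part
  whose degree differs from \<open>a - b\<close> by at most \<open>m\<close>.
\<close>
definition spread :: "nat \<Rightarrow> nat \<Rightarrow> 'a" where
  "spread m n = (\<Sum>\<gamma>\<in>words n. S_word S \<gamma> * (S 1 ^ m * S 2) * adj (S_word S \<gamma>))"

lemma spread_compress:
  "adj (spread m a) * x * spread m b = (\<Sum>\<gamma>\<in>words a. \<Sum>\<delta>\<in>words b. S_word S \<gamma> *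
     (adj (S 1 ^ m * S 2) * (adj (S_word S \<gamma>) * x * S_word S \<delta>) * (S 1 ^ m * S 2)) * adj (S_word S \<delta>))"
  unfolding spread_def adj_sum sum_distrib_right
  by (simp add: sum_distrib_left sum_distrib_right adj_mult adj_adj mult.assoc)

lemma spread_same_degree:
  assumes c: "corr S T a b x y"
  shows "adj (spread m a) * x * spread m b = x"
proof -
  let ?v = "S 1 ^ m * S 2"
  have iso: "adj ?v * ?v = 1"
    using S_word_isometry[OF S, of "replicate m 1 @ [2]"]
    by (simp add: S_word_replicate S_word_append set_replicate_conv_if)
  have "adj ?v * (adj (S_word S \<gamma>) * x * S_word S \<delta>) * ?v = adj (S_word S \<gamma>) * x * S_word S \<delta>"
    if w: "\<gamma> \<in> words a" "\<delta> \<in> words b" for \<gamma> \<delta>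
  proof -
    obtain d where d: "adj (S_word S \<gamma>) * x * S_word S \<delta> = scaleC d 1"
      using c w unfolding corr_def by blast
    have "adj ?v * scaleC d 1 * ?v = scaleC d (adj ?v * ?v)"
      by (simp add: scaleC_mult_left scaleC_mult_right)
    then show ?thesis unfolding d iso .
  qed
  then have "adj (spread m a) * x * spread m b = (\<Sum>\<gamma>\<in>words a. \<Sum>\<delta>\<in>words b. S_word S \<gamma> *
     (adj (S_word S \<gamma>) * x * S_word S \<delta>) * adj (S_word S \<delta>))"
    by (simp add: spread_compress)
  also have "\<dots> = (\<Sum>\<gamma>\<in>words a. S_word S \<gamma> * adj (S_word S \<gamma>)) * x * (\<Sum>\<delta>\<in>words b. S_word S \<delta> * adj (S_word S \<delta>))"
    unfolding sum_distrib_right by (simp add: sum_distrib_left mult.assoc)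
  finally show ?thesis by (simp add: S_word_resolution[OF S])
qed

end

text \<open>
  The compression by the isometries \<open>spread\<close> extracts one homogeneous component without increasing the
  norm. It takes the place of averaging over the gauge action, whose existence on the given algebra would itself
  require the uniqueness theorem.
\<close>
lemma norm_component_le:
  fixes S T :: "nat \<Rightarrow> 'a::unital_cstar_algebra"
  assumes S: "cuntz_family S" and T: "cuntz_family T"
    and I: "finite I" "j \<in> I" and q: "\<And>i. i \<in> I \<Longrightarrow> homogeneous S T i (q i) (r i)"
  shows "norm (q j) \<le> norm (\<Sum>i\<in>I. q i)"
proof -
  have "\<exists>B. \<forall>a\<ge>B. \<forall>b\<ge>B. int a - int b = i \<longrightarrow> corr S T a b (q i) (r i)" if i: "i \<in> I" for i
  proof -
    obtain a b where ab: "int a - int b = i" "corr S T a b (q i) (r i)"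
      using q[OF i] unfolding homogeneous_def by blast
    show ?thesis
    proof (intro exI[of _ "a + b"] allI impI)
      fix a' b' assume *: "a' \<ge> a + b" "b' \<ge> a + b" "int a' - int b' = i"
      then have "a' = a + (a' - a)" "b' = b + (a' - a)" using ab by linarith+
      then show "corr S T a' b' (q i) (r i)"
        using corr_raise[OF S T ab(2), of "a' - a"] by simp
    qed
  qed
  then obtain f where f: "\<And>i a b. i \<in> I \<Longrightarrow> a \<ge> f i \<Longrightarrow> b \<ge> f i \<Longrightarrow> int a - int b = i \<Longrightarrow> corr S T a b (q i) (r i)"
    by metis
  obtain B where B: "\<And>i. i \<in> I \<Longrightarrow> f i \<le> B"
    using finite_nat_set_iff_bounded_le[of "f ` I"] I by auto
  obtain m where m: "\<And>i. i \<in> I \<Longrightarrow> nat \<bar>i - j\<bar> \<le> m"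
    using finite_nat_set_iff_bounded_le[of "(\<lambda>i. nat \<bar>i - j\<bar>) ` I"] I by auto
  \<comment> \<open>Lengths with \<open>a - b = j\<close> beyond which every component has a matrix of the required shape.\<close>
  define a b where "a = B + nat j" and "b = B + nat (- j)"
  let ?w = "spread S m"
  have zero: "adj (?w a) * q i * ?w b = 0" if i: "i \<in> I" "i \<noteq> j" for i
  proof (cases "i > j")
    case True
    define l where "l = nat (i - j)"
    have l: "1 \<le> l" "l \<le> m" using True m[OF i(1)] by (auto simp: l_def)
    have "corr S T (a + l) b (q i) (r i)"
      by (rule f) (use B i True in \<open>auto simp: a_def b_def l_def intro: trans_le_add1\<close>)
    from corr_off_degree[OF S T this _ _ l] show ?thesis
      by (simp add: spread_compress[OF S T])
  next
    case False
    define l where "l = nat (j - i)"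
    have l: "1 \<le> l" "l \<le> m" using False i m[OF i(1)] by (auto simp: l_def)
    have "corr S T a (b + l) (q i) (r i)"
      by (rule f) (use B i False in \<open>auto simp: a_def b_def l_def intro: trans_le_add1\<close>)
    from corr_off_degree'[OF S T this _ _ l] show ?thesis
      by (simp add: spread_compress[OF S T])
  qed
  have "corr S T a b (q j) (r j)"
    by (rule f) (use B I in \<open>auto simp: a_def b_def intro: trans_le_add1\<close>)
  then have same: "adj (?w a) * q j * ?w b = q j" by (rule spread_same_degree[OF S T])
  have w1: "norm (?w n) \<le> 1" for n
  proof (rule norm_le_one_if_isometry)
    have "corr S T n n 1 1" using corr_raise[OF S T corr_one, of n] by simp
    from spread_same_degree[OF S T this, of m] show "adj (?w n) * ?w n = 1" by simp
  qed
  have "adj (?w a) * (\<Sum>i\<in>I. q i) * ?w b = (\<Sum>i\<in>I. adj (?w a) * q i * ?w b)"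
    by (simp add: sum_distrib_left sum_distrib_right)
  also have "\<dots> = (\<Sum>i\<in>{j}. adj (?w a) * q i * ?w b)"
    using I zero by (intro sum.mono_neutral_right) auto
  finally have "norm (q j) = norm (adj (?w a) * (\<Sum>i\<in>I. q i) * ?w b)" by (simp add: same)
  also have "\<dots> \<le> norm (adj (?w a)) * norm (\<Sum>i\<in>I. q i) * norm (?w b)"
    by (meson norm_mult_ineq mult_right_mono norm_ge_zero order_trans)
  also have "\<dots> \<le> 1 * norm (\<Sum>i\<in>I. q i) * 1"
    by (intro mult_mono) (use w1 in auto)
  finally show ?thesis by simp
qed

context
  fixes S T :: "nat \<Rightarrow> 'a::unital_cstar_algebra"
  assumes S: "cuntz_family S" and T: "cuntz_family T"
begin

lemma graded_add:
  assumes "graded S T m x y" "graded S T m x' y'"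
  shows "graded S T m (x + x') (y + y')"
proof -
  obtain q r q' r' where *: "\<forall>j\<in>{- int m..int m}. homogeneous S T j (q j) (r j)"
      "x = (\<Sum>j\<in>{- int m..int m}. q j)" "y = (\<Sum>j\<in>{- int m..int m}. r j)"
      "\<forall>j\<in>{- int m..int m}. homogeneous S T j (q' j) (r' j)"
      "x' = (\<Sum>j\<in>{- int m..int m}. q' j)" "y' = (\<Sum>j\<in>{- int m..int m}. r' j)"
    using assms unfolding graded_def by blast
  show ?thesis unfolding graded_def
    by (intro exI[of _ "\<lambda>j. q j + q' j"] exI[of _ "\<lambda>j. r j + r' j"])
       (use * in \<open>auto simp: sum.distrib intro: homogeneous_add[OF S T]\<close>)
qed

lemma graded_homogeneous:
  assumes "homogeneous S T j x y" "\<bar>j\<bar> \<le> int m"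
  shows "graded S T m x y"
  unfolding graded_def
  by (intro exI[of _ "\<lambda>i. if i = j then x else 0"] exI[of _ "\<lambda>i. if i = j then y else 0"])
     (use assms in \<open>auto simp: homogeneous_zero\<close>)

lemma graded_zero: "graded S T m 0 0"
  by (rule graded_homogeneous[OF homogeneous_zero[of _ _ 0]]) simp

lemma graded_sum:
  assumes "\<And>i. i \<in> I \<Longrightarrow> graded S T m (f i) (g i)"
  shows "graded S T m (\<Sum>i\<in>I. f i) (\<Sum>i\<in>I. g i)"
  using assms
  by (induction I rule: infinite_finite_induct) (auto intro: graded_add graded_zero)

lemma gradedE:
  assumes "graded S T m x y"
  obtains q r where "\<And>j. j \<in> {- int m..int m} \<Longrightarrow> homogeneous S T j (q j) (r j)"
    "x = (\<Sum>j\<in>{- int m..int m}. q j)" "y = (\<Sum>j\<in>{- int m..int m}. r j)"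
  using assms unfolding graded_def by blast

lemma graded_mult:
  assumes 1: "graded S T m x y" and 2: "graded S T n x' y'"
  shows "graded S T (m + n) (x * x') (y * y')"
proof (rule gradedE[OF 1], rule gradedE[OF 2])
  fix q r q' r' assume *: "\<And>j. j \<in> {- int m..int m} \<Longrightarrow> homogeneous S T j (q j) (r j)"
      "x = (\<Sum>j\<in>{- int m..int m}. q j)" "y = (\<Sum>j\<in>{- int m..int m}. r j)"
      "\<And>j. j \<in> {- int n..int n} \<Longrightarrow> homogeneous S T j (q' j) (r' j)"
      "x' = (\<Sum>j\<in>{- int n..int n}. q' j)" "y' = (\<Sum>j\<in>{- int n..int n}. r' j)"
  show ?thesis unfolding *(2,3,5,6) sum_product
    by (intro graded_sum graded_homogeneous[OF homogeneous_mult[OF S T *(1,4)]]) auto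
qed

lemma graded_adj:
  assumes 1: "graded S T m x y" shows "graded S T m (adj x) (adj y)"
proof (rule gradedE[OF 1])
  fix q r assume *: "\<And>j. j \<in> {- int m..int m} \<Longrightarrow> homogeneous S T j (q j) (r j)"
      "x = (\<Sum>j\<in>{- int m..int m}. q j)" "y = (\<Sum>j\<in>{- int m..int m}. r j)"
  show ?thesis unfolding *(2,3) adj_sum
    by (intro graded_sum graded_homogeneous[OF homogeneous_adj[OF *(1)]]) auto
qed

lemma graded_scaleC:
  assumes 1: "graded S T m x y" shows "graded S T m (scaleC c x) (scaleC c y)"
proof (rule gradedE[OF 1])
  fix q r assume *: "\<And>j. j \<in> {- int m..int m} \<Longrightarrow> homogeneous S T j (q j) (r j)"
      "x = (\<Sum>j\<in>{- int m..int m}. q j)" "y = (\<Sum>j\<in>{- int m..int m}. r j)"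
  show ?thesis unfolding *(2,3) scaleC_sum_right
    by (intro graded_sum graded_homogeneous[OF homogeneous_scaleC[OF *(1)]]) auto
qed

lemma graded_mono:
  assumes 1: "graded S T m x y" and "m \<le> n" shows "graded S T n x y"
proof (rule gradedE[OF 1])
  fix q r assume *: "\<And>j. j \<in> {- int m..int m} \<Longrightarrow> homogeneous S T j (q j) (r j)"
      "x = (\<Sum>j\<in>{- int m..int m}. q j)" "y = (\<Sum>j\<in>{- int m..int m}. r j)"
  show ?thesis unfolding *(2,3)
    by (intro graded_sum graded_homogeneous[OF *(1)]) (use assms in auto)
qed

lemma graded_one: "graded S T m 1 1"
proof -
  have "homogeneous S T 0 1 1" unfolding homogeneous_def using corr_one by force
  then show ?thesis by (rule graded_homogeneous) simp
qed

lemma graded_power: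
  assumes "graded S T m x y" shows "graded S T (m * n) (x ^ n) (y ^ n)"
  by (induction n) (use assms in \<open>simp_all add: graded_one graded_mult\<close>)

lemma graded_gen:
  assumes "i \<in> {1,2}" shows "graded S T 1 (S i) (T i)"
proof -
  have "homogeneous S T 1 (S i) (T i)" unfolding homogeneous_def using corr_gen[OF S T assms] by force
  then show ?thesis by (rule graded_homogeneous) simp
qed

text \<open>
  The components are compared one by one, at the cost of their number.
\<close>
lemma graded_bounded:
  assumes 1: "graded S T m x y" shows "norm y \<le> (2 * real m + 1) * norm x"
proof (rule gradedE[OF 1])
  fix q r assume *: "\<And>j. j \<in> {- int m..int m} \<Longrightarrow> homogeneous S T j (q j) (r j)"
      "x = (\<Sum>j\<in>{- int m..int m}. q j)" "y = (\<Sum>j\<in>{- int m..int m}. r j)"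
  have "norm y \<le> (\<Sum>j\<in>{- int m..int m}. norm (r j))" unfolding *(3) by (rule norm_sum)
  also have "\<dots> \<le> (\<Sum>j\<in>{- int m..int m}. norm x)"
  proof (rule sum_mono)
    fix j assume j: "j \<in> {- int m..int m}"
    have "norm (r j) \<le> norm (q j)" by (rule homogeneous_norm_le[OF S T *(1)[OF j]])
    also have "\<dots> \<le> norm x"
      unfolding *(2) by (rule norm_component_le[OF S T _ j *(1)]) auto
    finally show "norm (r j) \<le> norm x" .
  qed
  also have "\<dots> = (2 * real m + 1) * norm x" by simp
  finally show ?thesis .
qed

text \<open>
  The number of components of \<open>(x\<^sup>* x)\<^sup>n\<close> grows only linearly in \<open>n\<close>, so this loss disappears in the limit.
\<close>
lemma graded_norm_le:
  assumes 1: "graded S T m x y" shows "norm y \<le> norm x"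
proof (rule norm_le_if_powers_le)
  fix n
  have "graded S T ((m + m) * n) ((adj x * x) ^ n) ((adj y * y) ^ n)"
    by (intro graded_power graded_mult graded_adj 1)
  from graded_bounded[OF this]
  show "norm ((adj y * y) ^ n) \<le> ((4 * real m) * real n + 1) * norm ((adj x * x) ^ n)"
    by (simp add: mult.assoc)
qed auto

end

subsection \<open>Passage to the closure\<close>

text \<open>
  The closure of the graph of the map that sends a *-polynomial in \<open>S\<^sub>1, S\<^sub>2\<close> to the same one in \<open>T\<^sub>1, T\<^sub>2\<close>.
\<close>
definition lim_rel :: "(nat \<Rightarrow> 'a::unital_cstar_algebra) \<Rightarrow> (nat \<Rightarrow> 'a) \<Rightarrow> 'a \<Rightarrow> 'a \<Rightarrow> bool" where
  "lim_rel S T x y \<longleftrightarrow>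
     (\<exists>X Y. (\<forall>n. \<exists>m. graded S T m (X n) (Y n)) \<and> X \<longlonglongrightarrow> x \<and> Y \<longlonglongrightarrow> y)"

lemma bounded_linear_scaleC:
  "bounded_linear (scaleC c :: 'a::unital_cstar_algebra \<Rightarrow> 'a)"
proof (rule bounded_linear_intro[of _ "cmod c"])
  fix r and x :: 'a
  show "scaleC c (r *\<^sub>R x) = r *\<^sub>R scaleC c x"
    by (simp add: scaleC_scaleC mult.commute flip: scaleC_of_real)
qed (simp_all add: scaleC_add_right norm_scaleC mult.commute)

context
  fixes S T :: "nat \<Rightarrow> 'a::unital_cstar_algebra"
  assumes S: "cuntz_family S" and T: "cuntz_family T"
begin

lemma lim_rel_graded: "graded S T m x y \<Longrightarrow> lim_rel S T x y"
  unfolding lim_rel_def by (intro exI[of _ "\<lambda>_. x"] exI[of _ "\<lambda>_. y"]) auto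

lemma graded_common:
  assumes "graded S T m x y" "graded S T n x' y'"
  shows "graded S T (m + n) x y" "graded S T (m + n) x' y'"
  using assms by (auto intro: graded_mono[OF S T])

lemma lim_rel_add: "lim_rel S T x y \<Longrightarrow> lim_rel S T x' y' \<Longrightarrow> lim_rel S T (x + x') (y + y')"
  unfolding lim_rel_def
proof (elim exE conjE)
  fix X Y X' Y'
  assume *: "\<forall>n. \<exists>m. graded S T m (X n) (Y n)" "\<forall>n. \<exists>m. graded S T m (X' n) (Y' n)"
    "X \<longlonglongrightarrow> x" "X' \<longlonglongrightarrow> x'" "Y \<longlonglongrightarrow> y" "Y' \<longlonglongrightarrow> y'"
  show "\<exists>X Y. (\<forall>n. \<exists>m. graded S T m (X n) (Y n)) \<and> X \<longlonglongrightarrow> x + x' \<and> Y \<longlonglongrightarrow> y + y'"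
  proof (rule exI[of _ "\<lambda>n. X n + X' n"], rule exI[of _ "\<lambda>n. Y n + Y' n"], intro conjI allI)
    fix n
    obtain m k where "graded S T m (X n) (Y n)" "graded S T k (X' n) (Y' n)" using * by blast
    from graded_add[OF S T graded_common[OF this]]
    show "\<exists>m. graded S T m (X n + X' n) (Y n + Y' n)" by blast
  qed (use * in \<open>auto intro: tendsto_add\<close>)
qed

lemma lim_rel_mult: "lim_rel S T x y \<Longrightarrow> lim_rel S T x' y' \<Longrightarrow> lim_rel S T (x * x') (y * y')"
  unfolding lim_rel_def
proof (elim exE conjE)
  fix X Y X' Y'
  assume *: "\<forall>n. \<exists>m. graded S T m (X n) (Y n)" "\<forall>n. \<exists>m. graded S T m (X' n) (Y' n)"
    "X \<longlonglongrightarrow> x" "X' \<longlonglongrightarrow> x'" "Y \<longlonglongrightarrow> y" "Y' \<longlonglongrightarrow> y'"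
  show "\<exists>X Y. (\<forall>n. \<exists>m. graded S T m (X n) (Y n)) \<and> X \<longlonglongrightarrow> x * x' \<and> Y \<longlonglongrightarrow> y * y'"
  proof (rule exI[of _ "\<lambda>n. X n * X' n"], rule exI[of _ "\<lambda>n. Y n * Y' n"], intro conjI allI)
    fix n
    obtain m k where "graded S T m (X n) (Y n)" "graded S T k (X' n) (Y' n)" using * by blast
    from graded_mult[OF S T this]
    show "\<exists>m. graded S T m (X n * X' n) (Y n * Y' n)" by blast
  qed (use * in \<open>auto intro: tendsto_mult\<close>)
qed

lemma lim_rel_map:
  assumes f: "bounded_linear f" "\<And>m x y. graded S T m x y \<Longrightarrow> graded S T m (f x) (f y)"
    and l: "lim_rel S T x y"
  shows "lim_rel S T (f x) (f y)"
proof -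
  obtain X Y where *: "\<forall>n. \<exists>m. graded S T m (X n) (Y n)" "X \<longlonglongrightarrow> x" "Y \<longlonglongrightarrow> y"
    using l unfolding lim_rel_def by blast
  show ?thesis unfolding lim_rel_def
  proof (rule exI[of _ "\<lambda>n. f (X n)"], rule exI[of _ "\<lambda>n. f (Y n)"], intro conjI allI)
    fix n
    obtain m where "graded S T m (X n) (Y n)" using * by blast
    from f(2)[OF this] show "\<exists>m. graded S T m (f (X n)) (f (Y n))" by blast
  qed (use * in \<open>auto intro: bounded_linear.tendsto[OF f(1)]\<close>)
qed

lemma lim_rel_adj: "lim_rel S T x y \<Longrightarrow> lim_rel S T (adj x) (adj y)"
  by (rule lim_rel_map[OF bounded_linear_adj graded_adj[OF S T]])

lemma lim_rel_scaleC: "lim_rel S T x y \<Longrightarrow> lim_rel S T (scaleC c x) (scaleC c y)"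
  by (rule lim_rel_map[OF bounded_linear_scaleC graded_scaleC[OF S T]])

lemma lim_rel_norm_le:
  assumes "lim_rel S T x y" shows "norm y \<le> norm x"
proof -
  obtain X Y where *: "\<forall>n. \<exists>m. graded S T m (X n) (Y n)" "X \<longlonglongrightarrow> x" "Y \<longlonglongrightarrow> y"
    using assms unfolding lim_rel_def by blast
  have "norm (Y n) \<le> norm (X n)" for n
    using *(1) graded_norm_le[OF S T] by blast
  then show ?thesis
    using tendsto_norm[OF *(2)] tendsto_norm[OF *(3)]
    by (intro tendsto_le[OF sequentially_bot]) auto
qed

lemma lim_rel_unique:
  assumes "lim_rel S T x y" "lim_rel S T x y'" shows "y = y'"
proof -
  have "lim_rel S T (x + scaleC (-1) x) (y + scaleC (-1) y')"
    by (intro lim_rel_add lim_rel_scaleC assms)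
  from lim_rel_norm_le[OF this] have "norm (y - y') \<le> norm (0::'a)"
    by (simp add: scaleC_minus_one)
  then show ?thesis by simp
qed

text \<open>
  The first coordinates of approximating pairs converge, the second ones form a Cauchy sequence because
  the relation does not increase norms, and the algebra is complete.
\<close>
lemma lim_rel_closed:
  assumes "\<And>e. e > 0 \<Longrightarrow> \<exists>x' y'. lim_rel S T x' y' \<and> norm (x' - x) < e"
  shows "\<exists>y. lim_rel S T x y"
proof -
  have "\<exists>p. (\<exists>m. graded S T m (fst p) (snd p)) \<and> norm (fst p - x) < inverse (real (Suc n))" for n
  proof -
    define e where "e = inverse (real (Suc n)) / 2"
    have e: "e > 0" by (simp add: e_def)
    obtain x' y' where x': "lim_rel S T x' y'" "norm (x' - x) < e" using assms[OF e] by blast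
    then obtain X Y where *: "\<forall>n. \<exists>m. graded S T m (X n) (Y n)" "X \<longlonglongrightarrow> x'"
      unfolding lim_rel_def by blast
    obtain k where k: "norm (X k - x') < e" using LIMSEQ_D[OF *(2) e] by blast
    have "norm (X k - x) \<le> norm (X k - x') + norm (x' - x)"
      using norm_triangle_ineq[of "X k - x'" "x' - x"] by simp
    then have "norm (X k - x) < inverse (real (Suc n))" using k x' by (simp add: e_def)
    then show ?thesis using *(1) by (intro exI[of _ "(X k, Y k)"]) simp
  qed
  then have "\<forall>n. \<exists>p. (\<exists>m. graded S T m (fst p) (snd p)) \<and> norm (fst p - x) < inverse (real (Suc n))"
    by blast
  from choice[OF this] obtain P where P: "\<And>n. \<exists>m. graded S T m (fst (P n)) (snd (P n))"
      "\<And>n. norm (fst (P n) - x) < inverse (real (Suc n))"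
    by blast
  have X: "(\<lambda>n. fst (P n)) \<longlonglongrightarrow> x"
  proof (rule LIMSEQ_I)
    fix r :: real assume "0 < r"
    then obtain n0 where n0: "inverse (real (Suc n0)) < r" using reals_Archimedean by blast
    have "norm (fst (P n) - x) < r" if "n \<ge> n0" for n
    proof -
      have "inverse (real (Suc n)) \<le> inverse (real (Suc n0))" using that by simp
      then show ?thesis using P(2)[of n] n0 by linarith
    qed
    then show "\<exists>no. \<forall>n\<ge>no. norm (fst (P n) - x) < r" by blast
  qed
  have le: "norm (snd (P m) - snd (P n)) \<le> norm (fst (P m) - fst (P n))" for m n
  proof -
    have l: "lim_rel S T (fst (P k)) (snd (P k))" for k
      using P(1)[of k] lim_rel_graded by blast
    have "lim_rel S T (fst (P m) + scaleC (-1) (fst (P n))) (snd (P m) + scaleC (-1) (snd (P n)))"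
      by (intro lim_rel_add lim_rel_scaleC l)
    from lim_rel_norm_le[OF this] show ?thesis by (simp add: scaleC_minus_one)
  qed
  have "Cauchy (\<lambda>n. fst (P n))" using X by (rule LIMSEQ_imp_Cauchy)
  then have "Cauchy (\<lambda>n. snd (P n))"
    unfolding Cauchy_iff using order_le_less_trans[OF le] by metis
  then obtain y where "(\<lambda>n. snd (P n)) \<longlonglongrightarrow> y"
    using Cauchy_convergent_iff convergent_def by blast
  then show ?thesis unfolding lim_rel_def
    by (intro exI conjI) (use P(1) X in auto)
qed

end

lemma lim_rel_total:
  assumes S: "cuntz_O2 S" and T: "cuntz_family T"
  shows "\<exists>y. lim_rel S T x y"
proof -
  note S' = cuntz_O2_family[OF S]
  let ?B = "{x. \<exists>y. lim_rel S T x y}"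
  have "closed ?B"
    unfolding closed_def open_dist
  proof (intro ballI, rule ccontr)
    fix x assume x: "x \<in> - ?B" and n: "\<not> (\<exists>e>0. \<forall>y. dist y x < e \<longrightarrow> y \<in> - ?B)"
    have "\<exists>y. lim_rel S T x y"
    proof (rule lim_rel_closed[OF S' T])
      fix e :: real assume "e > 0"
      then obtain z where "dist z x < e" "z \<in> ?B" using n by blast
      then show "\<exists>x' y'. lim_rel S T x' y' \<and> norm (x' - x) < e" by (auto simp: dist_norm)
    qed
    then show False using x by simp
  qed
  moreover have "1 \<in> ?B" using lim_rel_graded[OF S' T graded_one[OF S' T]] by blast
  moreover have "x + y \<in> ?B" "x * y \<in> ?B" "adj x \<in> ?B" "scaleC c x \<in> ?B"
    if xy: "x \<in> ?B" "y \<in> ?B" for x y c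
  proof -
    obtain x' y' where l: "lim_rel S T x x'" "lim_rel S T y y'" using xy by blast
    show "x + y \<in> ?B" "x * y \<in> ?B" "adj x \<in> ?B" "scaleC c x \<in> ?B"
      using lim_rel_add[OF S' T l] lim_rel_mult[OF S' T l] lim_rel_adj[OF S' T l(1)]
        lim_rel_scaleC[OF S' T l(1)] by blast+
  qed
  ultimately have "cstar_subalgebra ?B"
    unfolding cstar_subalgebra_def by blast
  moreover have "S i \<in> ?B" if "i \<in> {1,2}" for i
    using lim_rel_graded[OF S' T graded_gen[OF S' T that]] by blast
  ultimately show ?thesis using cstar_hull_UNIV_induct[OF S, of ?B x] by blast
qed

text \<open>
  The closed graph is a function, since it does not increase norms, and its domain is a C*-subalgebra
  that contains the generators.
\<close>
theorem cuntz_universal: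
  assumes S: "cuntz_O2 S" and T: "cuntz_family T"
  obtains \<phi> where "star_endomorphism \<phi>" "\<phi> (S 1) = T 1" "\<phi> (S 2) = T 2"
proof -
  note S' = cuntz_O2_family[OF S]
  have "\<forall>x. \<exists>y. lim_rel S T x y" using lim_rel_total[OF S T] by blast
  from choice[OF this] obtain \<phi> where \<phi>: "\<And>x. lim_rel S T x (\<phi> x)" by blast
  have e: "\<phi> x = y" if "lim_rel S T x y" for x y
    using lim_rel_unique[OF S' T \<phi> that] .
  have "star_endomorphism \<phi>"
    unfolding star_endomorphism_def
    by (intro conjI allI e lim_rel_add[OF S' T] lim_rel_mult[OF S' T] lim_rel_adj[OF S' T]
        lim_rel_scaleC[OF S' T] \<phi> lim_rel_graded[OF S' T graded_one[OF S' T]])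
  moreover have "\<phi> (S 1) = T 1" "\<phi> (S 2) = T 2"
    by (intro e lim_rel_graded[OF S' T graded_gen[OF S' T]]; simp)+
  ultimately show ?thesis using that by blast
qed

lemma cuntz_endo_spec:
  assumes S: "cuntz_O2 S" and u: "is_unitary u"
  shows "star_endomorphism (cuntz_endo S u)"
    and "\<And>i. i \<in> {1, 2} \<Longrightarrow> cuntz_endo S u (S i) = adj u * S i"
proof -
  have uu: "u * adj u = 1" "adj u * u = 1" using u by (auto simp: is_unitary_def)
  have T: "cuntz_family (\<lambda>i. adj u * S i)"
  proof -
    have iso: "adj (adj u * S i) * (adj u * S i) = adj (S i) * S i" for i
      by (metis adj_adj adj_mult mult.assoc mult_1 uu(1))
    have "adj u * S 1 * adj (adj u * S 1) + adj u * S 2 * adj (adj u * S 2)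
        = adj u * (S 1 * adj (S 1) + S 2 * adj (S 2)) * u"
      by (simp add: adj_mult adj_adj distrib_left distrib_right mult.assoc)
    then show ?thesis using S by (simp add: cuntz_family_def iso cuntz_O2_def uu)
  qed
  have "\<exists>!\<phi>. star_endomorphism \<phi> \<and> (\<forall>i\<in>{1, 2}. \<phi> (S i) = adj u * S i)"
  proof (rule ex_ex1I)
    show "\<exists>\<phi>. star_endomorphism \<phi> \<and> (\<forall>i\<in>{1, 2}. \<phi> (S i) = adj u * S i)"
      by (rule cuntz_universal[OF S T]) auto
  qed (use star_endo_eqI[OF S] in auto)
  from theI'[OF this] show "star_endomorphism (cuntz_endo S u)"
    and "\<And>i. i \<in> {1, 2} \<Longrightarrow> cuntz_endo S u (S i) = adj u * S i"
    unfolding cuntz_endo_def by auto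
qed

lemma graded_dense:
  assumes S: "cuntz_O2 S" and e: "e > 0"
  obtains m p p' where "graded S S m p p'" "norm (x - p) < e"
proof -
  obtain y where "lim_rel S S x y" using lim_rel_total[OF S cuntz_O2_family[OF S]] by blast
  then obtain X Y where *: "\<forall>n. \<exists>m. graded S S m (X n) (Y n)" "X \<longlonglongrightarrow> x"
    unfolding lim_rel_def by blast
  obtain k where "norm (X k - x) < e" using LIMSEQ_D[OF *(2) e] by blast
  then show ?thesis using that *(1) by (metis norm_minus_commute)
qed

section \<open>Permutation unitaries and transducers\<close>

lemma perm_unitary_S_word:
  assumes S: "cuntz_family S" and \<alpha>: "\<alpha> \<in> words k"
  shows "perm_unitary S k \<sigma> * S_word S \<alpha> = S_word S (\<sigma> \<alpha>)"
proof -
  have "perm_unitary S k \<sigma> * S_word S \<alpha>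
      = (\<Sum>\<beta>\<in>words k. S_word S (\<sigma> \<beta>) * (adj (S_word S \<beta>) * S_word S \<alpha>))"
    by (simp add: perm_unitary_def sum_distrib_right mult.assoc)
  also have "\<dots> = (\<Sum>\<beta>\<in>words k. if \<beta> = \<alpha> then S_word S (\<sigma> \<alpha>) else 0)"
    by (rule sum.cong) (simp_all add: S_word_orth[OF S _ \<alpha>])
  also have "\<dots> = S_word S (\<sigma> \<alpha>)" using \<alpha> by simp
  finally show ?thesis .
qed

lemma perm_unitary_unitary:
  assumes S: "cuntz_family S" and \<sigma>: "bij_betw \<sigma> (words k) (words k)"
  shows "is_unitary (perm_unitary S k \<sigma>)"
proof -
  let ?U = "perm_unitary S k \<sigma>"
  have adj: "adj ?U = (\<Sum>\<alpha>\<in>words k. S_word S \<alpha> * adj (S_word S (\<sigma> \<alpha>)))"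
    by (simp add: perm_unitary_def adj_sum adj_mult adj_adj)
  have "?U * adj ?U = (\<Sum>\<alpha>\<in>words k. ?U * S_word S \<alpha> * adj (S_word S (\<sigma> \<alpha>)))"
    by (simp add: adj sum_distrib_left mult.assoc)
  also have "\<dots> = (\<Sum>\<alpha>\<in>words k. S_word S (\<sigma> \<alpha>) * adj (S_word S (\<sigma> \<alpha>)))"
    by (rule sum.cong) (simp_all add: perm_unitary_S_word[OF S])
  also have "\<dots> = (\<Sum>\<alpha>\<in>words k. S_word S \<alpha> * adj (S_word S \<alpha>))"
    by (rule sum.reindex_bij_betw[OF \<sigma>])
  finally have 1: "?U * adj ?U = 1" by (simp add: S_word_resolution[OF S])
  have "adj ?U * ?U = 1"
  proof (rule eq_if_eq_on_words[OF S, of k])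
    fix \<alpha> assume \<alpha>: "\<alpha> \<in> words k"
    have m: "\<sigma> \<beta> \<in> words k" if "\<beta> \<in> words k" for \<beta> using \<sigma> that by (auto simp: bij_betw_def)
    have "adj ?U * ?U * S_word S \<alpha> = adj ?U * S_word S (\<sigma> \<alpha>)"
      by (simp add: mult.assoc perm_unitary_S_word[OF S \<alpha>])
    also have "\<dots> = (\<Sum>\<beta>\<in>words k. S_word S \<beta> * (adj (S_word S (\<sigma> \<beta>)) * S_word S (\<sigma> \<alpha>)))"
      by (simp add: adj sum_distrib_right mult.assoc)
    also have "\<dots> = (\<Sum>\<beta>\<in>words k. if \<beta> = \<alpha> then S_word S \<alpha> else 0)"
      using \<sigma> \<alpha> by (intro sum.cong) (auto simp: S_word_orth[OF S m m] bij_betw_def dest: inj_onD)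
    finally show "adj ?U * ?U * S_word S \<alpha> = 1 * S_word S \<alpha>" using \<alpha> by simp
  qed
  with 1 show ?thesis by (simp add: is_unitary_def)
qed

text \<open>
  The unitary of a permutation \<open>\<sigma>\<close> satisfies \<open>\<lambda>\<^sub>\<sigma>(S\<^sub>i) S\<^sub>\<beta> = S\<^sub>\<alpha>\<close> whenever \<open>\<sigma>(\<alpha>) = i \<beta>\<close>. Read from right to left this is
  one step of a transducer: it splits off the letter \<open>i\<close> and leaves \<open>\<beta>\<close>. The transducer keeps the three letters
  of \<open>\<beta>\<close> as its state, and the next letter of the input completes them to a word of length four.
\<close>
definition encodes ::
  "(nat \<Rightarrow> 'a::unital_cstar_algebra) \<Rightarrow> ('a \<Rightarrow> 'a) \<Rightarrow> (nat list \<Rightarrow> nat list) \<Rightarrow> bool" where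
  "encodes S \<phi> \<tau> \<longleftrightarrow> (\<forall>\<alpha>\<in>words 4. \<tau> \<alpha> \<in> words 4 \<and>
     S_word S \<alpha> = \<phi> (S (hd (\<tau> \<alpha>))) * S_word S (tl (\<tau> \<alpha>)))"

fun emit :: "(nat list \<Rightarrow> nat list) \<Rightarrow> nat list \<Rightarrow> nat list \<Rightarrow> nat list" where
  "emit \<tau> s [] = []"
| "emit \<tau> s (c # cs) = hd (\<tau> (s @ [c])) # emit \<tau> (tl (\<tau> (s @ [c]))) cs"

fun final_state :: "(nat list \<Rightarrow> nat list) \<Rightarrow> nat list \<Rightarrow> nat list \<Rightarrow> nat list" where
  "final_state \<tau> s [] = s"
| "final_state \<tau> s (c # cs) = final_state \<tau> (tl (\<tau> (s @ [c]))) cs"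

lemma length_emit [simp]: "length (emit \<tau> s cs) = length cs"
  by (induction cs arbitrary: s) auto

lemma in_words_iff: "\<alpha> \<in> words k \<longleftrightarrow> length \<alpha> = k \<and> set \<alpha> \<subseteq> {1,2}"
  by (simp add: words_def)

lemma encodes_step:
  assumes "encodes S \<phi> \<tau>" "s \<in> words 3" "c \<in> {1,2}"
  obtains i \<beta> where "\<tau> (s @ [c]) = i # \<beta>" "i \<in> {1,2}" "\<beta> \<in> words 3"
    "S_word S (s @ [c]) = \<phi> (S i) * S_word S \<beta>"
proof -
  have w: "s @ [c] \<in> words 4" using assms(2,3) by (auto simp: in_words_iff)
  then have "\<tau> (s @ [c]) \<in> words 4" using assms(1) by (auto simp: encodes_def)
  then obtain i \<beta> where *: "\<tau> (s @ [c]) = i # \<beta>" "i \<in> {1,2}" "\<beta> \<in> words 3"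
    by (auto simp: numeral_eq_Suc words_Suc)
  have "S_word S (s @ [c]) = \<phi> (S (hd (\<tau> (s @ [c])))) * S_word S (tl (\<tau> (s @ [c])))"
    using assms(1) w unfolding encodes_def by blast
  with * that show ?thesis by simp
qed

text \<open>
  The emitted word is the beginning of the image of \<open>s cs\<close> under the homeomorphism of the Cantor space that
  \<open>\<phi>\<close> induces on the spectrum of the diagonal.
\<close>
lemma encodes_run:
  assumes e: "encodes S \<phi> \<tau>" and \<phi>: "star_endomorphism \<phi>"
    and s: "s \<in> words 3" and cs: "set cs \<subseteq> {1,2}"
  shows "S_word S (s @ cs) = \<phi> (S_word S (emit \<tau> s cs)) * S_word S (final_state \<tau> s cs)"
    and "set (emit \<tau> s cs) \<subseteq> {1,2}" and "final_state \<tau> s cs \<in> words 3"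
  using s cs
proof (induction cs arbitrary: s)
  case (Cons c cs)
  {
    case 1
    then obtain i \<beta> where *: "\<tau> (s @ [c]) = i # \<beta>" "i \<in> {1,2}" "\<beta> \<in> words 3"
      "S_word S (s @ [c]) = \<phi> (S i) * S_word S \<beta>"
      using encodes_step[OF e 1(1), of c] by auto
    have "S_word S (s @ c # cs) = S_word S (s @ [c]) * S_word S cs"
      by (simp add: S_word_append mult.assoc)
    also have "\<dots> = \<phi> (S i) * S_word S \<beta> * S_word S cs" by (simp only: *(4))
    also have "\<dots> = \<phi> (S i) * S_word S (\<beta> @ cs)" by (simp add: S_word_append mult.assoc)
    also have "\<dots> = \<phi> (S i) * (\<phi> (S_word S (emit \<tau> \<beta> cs)) * S_word S (final_state \<tau> \<beta> cs))"
      using Cons.IH(1)[OF *(3)] 1(2) by simp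
    finally show ?case by (simp add: * star_endo_mult[OF \<phi>] mult.assoc)
  next
    case 2
    then have "c \<in> {1,2}" by simp
    from encodes_step[OF e 2(1) this]
    obtain i \<beta> where *: "\<tau> (s @ [c]) = i # \<beta>" "i \<in> {1,2}" "\<beta> \<in> words 3" by metis
    then show ?case using Cons.IH(2)[OF *(3)] 2(2) by simp
  next
    case 3
    then have "c \<in> {1,2}" by simp
    from encodes_step[OF e 3(1) this]
    obtain i \<beta> where *: "\<tau> (s @ [c]) = i # \<beta>" "i \<in> {1,2}" "\<beta> \<in> words 3" by metis
    then show ?case using Cons.IH(3)[OF *(3)] 3(2) by simp
  }
qed (use star_endo_one[OF \<phi>] in simp_all)

section \<open>The square of the composite of the two automorphisms\<close>

definition flip :: "nat list \<Rightarrow> nat list" where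
  "flip \<alpha> = map (\<lambda>i. 3 - i) \<alpha>"

text \<open>
  The transducer of \<open>\<lambda>\<^sub>F \<circ> \<lambda>\<^sub>A\<close>: since \<open>\<lambda>\<^sub>F\<close> exchanges the letters in every word, the input and the state
  are flipped while the emitted letter is not.
\<close>
definition FA_perm :: "nat list \<Rightarrow> nat list" where
  "FA_perm \<alpha> = (let \<beta> = A_perm (flip \<alpha>) in hd \<beta> # flip (tl \<beta>))"

text \<open>
  The homeomorphism of the Cantor space induced by \<open>(\<lambda>\<^sub>F \<circ> \<lambda>\<^sub>A)\<^sup>2\<close> changes only finitely many leading letters:
  a point that begins with \<open>\<mu>\<close> is sent to the point with the prefix \<open>\<nu>\<close> instead, for the pairs \<open>(\<nu>, \<mu>)\<close> below. The
  first and the second entries each form a complete prefix code, and paired entries have equal length, so that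
  the replacement of prefixes permutes the words of length six.
\<close>
definition V_table :: "(nat list \<times> nat list) list" where
  "V_table =
    [([2,2], [2,1]),
     ([1,1,1,2], [1,2,2,2]),
     ([1,2,2,1], [1,1,2,1]),
     ([1,2,2,2], [1,1,1,2]),
     ([2,1,1,1], [2,2,2,1]),
     ([2,1,1,2], [2,2,1,2]),
     ([2,1,2,1], [2,2,1,1]),
     ([2,1,2,2], [2,2,2,2]),
     ([1,1,2,2,1], [1,2,1,2,1]),
     ([1,1,2,2,2], [1,2,1,1,2]),
     ([1,2,1,1,1], [1,1,1,1,1]),
     ([1,2,1,1,2], [1,1,2,2,2]),
     ([1,2,1,2,1], [1,1,2,2,1]),
     ([1,2,1,2,2], [1,1,1,1,2]),
     ([1,1,1,1,1,1], [1,2,2,1,1,1]),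
     ([1,1,1,1,1,2], [1,2,2,1,2,2]),
     ([1,1,1,1,2,1], [1,2,2,1,2,1]),
     ([1,1,1,1,2,2], [1,2,2,1,1,2]),
     ([1,1,2,1,1,1], [1,2,1,1,1,1]),
     ([1,1,2,1,1,2], [1,2,1,2,2,2]),
     ([1,1,2,1,2,1], [1,2,1,2,2,1]),
     ([1,1,2,1,2,2], [1,2,1,1,1,2])]"

text \<open>
  A word of length at least six has exactly one of the first entries as a prefix, so the default value is not
  met there.
\<close>
definition V_perm :: "nat list \<Rightarrow> nat list" where
  "V_perm \<alpha> = (case List.find (\<lambda>(\<nu>, \<mu>). take (length \<nu>) \<alpha> = \<nu>) V_table of
     Some (\<nu>, \<mu>) \<Rightarrow> \<mu> @ drop (length \<nu>) \<alpha> | None \<Rightarrow> \<alpha>)"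

primrec word_list :: "nat \<Rightarrow> nat list list" where
  "word_list 0 = [[]]"
| "word_list (Suc k) = map ((#) 1) (word_list k) @ map ((#) 2) (word_list k)"

lemma set_word_list: "set (word_list k) = words k"
  by (induction k) (simp_all add: words_Suc)

text \<open>
  Let \<open>\<psi> = \<lambda>\<^sub>F \<circ> \<lambda>\<^sub>A\<close> and let \<open>v\<close> be the unitary of \<open>V_perm\<close>, so that \<open>v S\<^sub>w = S\<^sub>x\<close> and \<open>v S\<^sub>i S\<^sub>w = S\<^sub>y\<close>. If the
  transducer turns \<open>x\<close> into \<open>n\<close> and \<open>y\<close> into \<open>m\<close> with the same final state \<open>s\<close>, and then \<open>m\<close> into the letter \<open>i\<close> with
  remainder \<open>n\<close>, then \<open>S\<^sub>y = \<psi>(S\<^sub>m) S\<^sub>s = \<psi>(\<psi>(S\<^sub>i)) \<psi>(S\<^sub>n) S\<^sub>s = \<psi>(\<psi>(S\<^sub>i)) S\<^sub>x\<close>. Running the transducer forward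
  means that inverse permutations never have to be computed.
\<close>
definition square_check :: "nat \<Rightarrow> nat list \<Rightarrow> bool" where
  "square_check i w \<longleftrightarrow> (let x = V_perm w; y = V_perm (take 6 (i # w)) @ drop 6 (i # w) in
     FA_perm (emit FA_perm (take 3 y) (drop 3 y)) = i # emit FA_perm (take 3 x) (drop 3 x) \<and>
     final_state FA_perm (take 3 y) (drop 3 y) = final_state FA_perm (take 3 x) (drop 3 x))"

lemma square_check_all: "\<forall>w\<in>words 6. square_check 1 w \<and> square_check 2 w"
proof -
  have "list_all (\<lambda>w. square_check 1 w \<and> square_check 2 w) (word_list 6)"
    by code_simp
  then show ?thesis by (simp add: list_all_iff set_word_list)
qed

lemma V_perm_bij: "bij_betw V_perm (words 6) (words 6)"
proof -
  have *: "list_all (\<lambda>w. length (V_perm w) = 6 \<and> list_all (\<lambda>i. i = 1 \<or> i = 2) (V_perm w)) (word_list 6)"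
    by code_simp
  have sub: "V_perm ` words 6 \<subseteq> words 6"
  proof (rule image_subsetI)
    fix w assume "w \<in> words 6"
    then have "length (V_perm w) = 6 \<and> (\<forall>i\<in>set (V_perm w). i = 1 \<or> i = 2)"
      using * by (simp add: list_all_iff set_word_list)
    then show "V_perm w \<in> words 6" unfolding in_words_iff by blast
  qed
  have "distinct (map V_perm (word_list 6))" by code_simp
  then have "inj_on V_perm (words 6)" by (simp add: distinct_map set_word_list)
  then show ?thesis
    using sub endo_inj_surj[OF finite_words sub] by (simp add: bij_betw_def)
qed


context
  fixes S :: "nat \<Rightarrow> 'a::unital_cstar_algebra"
  assumes S: "cuntz_O2 S"
begin

abbreviation "\<Lambda>A \<equiv> cuntz_endo S (perm_unitary S 4 A_perm)"
abbreviation "\<Lambda>F \<equiv> cuntz_endo S (F_unitary S)"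

lemma A_unitary: "is_unitary (perm_unitary S 4 A_perm)"
  by (rule perm_unitary_unitary[OF cuntz_O2_family[OF S] permutes_imp_bij[OF A_perm_permutes]])

lemma F_unitary_unitary: "is_unitary (F_unitary S)"
proof -
  have o: "adj (S 1) * S 1 = 1" "adj (S 2) * S 2 = 1" "adj (S 1) * S 2 = 0" "adj (S 2) * S 1 = 0"
    using cuntz_family_orth[OF cuntz_O2_family[OF S], of 1 1]
      cuntz_family_orth[OF cuntz_O2_family[OF S], of 1 2]
      cuntz_family_orth[OF cuntz_O2_family[OF S], of 2 1]
      cuntz_family_orth[OF cuntz_O2_family[OF S], of 2 2] by simp_all
  have m: "x * adj (S i) * (S j * y) = x * (adj (S i) * S j) * y" for i j x y
    by (simp add: mult.assoc)
  have "F_unitary S * F_unitary S = S 1 * adj (S 1) + S 2 * adj (S 2)"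
    unfolding F_unitary_def distrib_left distrib_right m o by simp
  moreover have "adj (F_unitary S) = F_unitary S"
    by (simp add: F_unitary_def adj_add adj_mult adj_adj add.commute)
  ultimately show ?thesis using S by (simp add: is_unitary_def cuntz_O2_def)
qed

lemmas endo_A = cuntz_endo_spec(1)[OF S A_unitary] and endo_F = cuntz_endo_spec(1)[OF S F_unitary_unitary]

lemma F_gen: "i \<in> {1,2} \<Longrightarrow> \<Lambda>F (S i) = S (3 - i)"
proof -
  assume i: "i \<in> {1,2}"
  have "adj (F_unitary S) = F_unitary S"
    by (simp add: F_unitary_def adj_add adj_mult adj_adj add.commute)
  then have "\<Lambda>F (S i) = S 1 * (adj (S 2) * S i) + S 2 * (adj (S 1) * S i)"
    by (simp add: cuntz_endo_spec(2)[OF S F_unitary_unitary i])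
       (simp add: F_unitary_def distrib_right mult.assoc)
  moreover have "adj (S 2) * S i = (if 2 = i then 1 else 0)" "adj (S 1) * S i = (if 1 = i then 1 else 0)"
    using cuntz_family_orth[OF cuntz_O2_family[OF S] _ i] by auto
  ultimately show ?thesis using i by auto
qed

lemma F_S_word: "set \<alpha> \<subseteq> {1,2} \<Longrightarrow> \<Lambda>F (S_word S \<alpha>) = S_word S (flip \<alpha>)"
  by (induction \<alpha>) (simp_all add: star_endo_one[OF endo_F] star_endo_mult[OF endo_F] F_gen flip_def)

lemma A_encodes: "encodes S \<Lambda>A A_perm"
  unfolding encodes_def
proof (intro ballI conjI)
  fix \<alpha> assume \<alpha>: "\<alpha> \<in> words 4"
  let ?U = "perm_unitary S 4 A_perm"
  show w: "A_perm \<alpha> \<in> words 4" using \<alpha> permutes_in_image[OF A_perm_permutes] by blast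
  then obtain i \<beta> where i: "A_perm \<alpha> = i # \<beta>" "i \<in> {1,2}"
    by (auto simp: numeral_eq_Suc words_Suc)
  have "\<Lambda>A (S i) * S_word S \<beta> = adj ?U * S_word S (A_perm \<alpha>)"
    by (simp add: cuntz_endo_spec(2)[OF S A_unitary i(2)] i mult.assoc)
  also have "\<dots> = adj ?U * ?U * S_word S \<alpha>"
    by (simp add: perm_unitary_S_word[OF cuntz_O2_family[OF S] \<alpha>] mult.assoc)
  also have "\<dots> = S_word S \<alpha>" using A_unitary by (simp add: is_unitary_def)
  finally show "S_word S \<alpha> = \<Lambda>A (S (hd (A_perm \<alpha>))) * S_word S (tl (A_perm \<alpha>))"
    by (simp add: i)
qed

lemma flip_words: "\<alpha> \<in> words k \<Longrightarrow> flip \<alpha> \<in> words k"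
  by (auto simp: in_words_iff flip_def)

lemma flip_flip: "set \<alpha> \<subseteq> {1,2} \<Longrightarrow> flip (flip \<alpha>) = \<alpha>"
  unfolding flip_def by (induction \<alpha>) auto

lemma FA_encodes: "encodes S (\<Lambda>F \<circ> \<Lambda>A) FA_perm"
  unfolding encodes_def
proof (intro ballI conjI)
  fix \<alpha> assume \<alpha>: "\<alpha> \<in> words 4"
  note f = flip_words[OF \<alpha>]
  have w: "A_perm (flip \<alpha>) \<in> words 4"
    and e: "S_word S (flip \<alpha>) = \<Lambda>A (S (hd (A_perm (flip \<alpha>)))) * S_word S (tl (A_perm (flip \<alpha>)))"
    using A_encodes f by (auto simp: encodes_def)
  then obtain i \<beta> where i: "A_perm (flip \<alpha>) = i # \<beta>" "i \<in> {1,2}" "\<beta> \<in> words 3"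
    by (auto simp: numeral_eq_Suc words_Suc)
  show "FA_perm \<alpha> \<in> words 4"
    using flip_words[OF i(3)] i by (auto simp: FA_perm_def Let_def in_words_iff)
  have "S_word S \<alpha> = \<Lambda>F (S_word S (flip \<alpha>))"
    using f \<alpha> by (subst F_S_word) (auto simp: in_words_iff flip_flip)
  also have "\<dots> = \<Lambda>F (\<Lambda>A (S i)) * S_word S (flip \<beta>)"
    using i by (simp add: e star_endo_mult[OF endo_F] F_S_word in_words_iff)
  finally show "S_word S \<alpha> = (\<Lambda>F \<circ> \<Lambda>A) (S (hd (FA_perm \<alpha>))) * S_word S (tl (FA_perm \<alpha>))"
    by (simp add: FA_perm_def i)
qed

lemma F_square: "\<Lambda>F \<circ> \<Lambda>F = id"
proof (rule star_endo_eqI[OF S star_endo_comp[OF endo_F endo_F]])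
  show "star_endomorphism (id :: 'a \<Rightarrow> 'a)" by (simp add: star_endomorphism_def)
qed (simp_all add: F_gen[of 1, simplified] F_gen[of 2, simplified])

text \<open>
  The check on words gives \<open>\<psi>(\<psi>(S\<^sub>i)) v = v S\<^sub>i\<close>, and a *-endomorphism is determined by its values on the
  generators.
\<close>
lemma FA_square: "(\<Lambda>F \<circ> \<Lambda>A) \<circ> (\<Lambda>F \<circ> \<Lambda>A) = Ad (perm_unitary S 6 V_perm)"
proof -
  let ?\<psi> = "\<Lambda>F \<circ> \<Lambda>A" and ?v = "perm_unitary S 6 V_perm"
  note F = cuntz_O2_family[OF S]
  have \<psi>: "star_endomorphism ?\<psi>" by (rule star_endo_comp[OF endo_F endo_A])
  have v: "is_unitary ?v" by (rule perm_unitary_unitary[OF F V_perm_bij])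
  have gen: "(?\<psi> \<circ> ?\<psi>) (S i) = Ad ?v (S i)" if i: "i \<in> {1,2}" for i
  proof -
    have "?\<psi> (?\<psi> (S i)) * ?v = ?v * S i"
    proof (rule eq_if_eq_on_words[OF F, of 6])
      fix w assume w: "w \<in> words 6"
      define x where "x = V_perm w"
      define z where "z = take 6 (i # w)"
      define y where "y = V_perm z @ drop 6 (i # w)"
      have z: "z \<in> words 6"
        using w i by (auto simp: z_def in_words_iff dest: in_set_takeD)
      have Vz: "V_perm z \<in> words 6" and x: "x \<in> words 6"
        using V_perm_bij z w by (auto simp: bij_betw_def x_def)
      have iw: "i # w = z @ drop 6 (i # w)" unfolding z_def by simp
      have d: "length (drop 6 (i # w)) = 1" "set (drop 6 (i # w)) \<subseteq> {1,2}"
        using w i by (auto simp: in_words_iff dest!: in_set_dropD)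
      have y: "length y = 7" "set y \<subseteq> {1,2}" using Vz d by (auto simp: y_def in_words_iff)
      define m n where "m = emit FA_perm (take 3 y) (drop 3 y)"
        and "n = emit FA_perm (take 3 x) (drop 3 x)"
      have t: "take 3 x \<in> words 3" "set (drop 3 x) \<subseteq> {1,2}" "take 3 y \<in> words 3" "set (drop 3 y) \<subseteq> {1,2}"
        using x y by (auto simp: in_words_iff dest: in_set_takeD in_set_dropD)
      have "square_check i w" using square_check_all w i by blast
      then have c: "FA_perm m = i # n"
        "final_state FA_perm (take 3 y) (drop 3 y) = final_state FA_perm (take 3 x) (drop 3 x)"
        by (auto simp: square_check_def Let_def m_def n_def x_def y_def z_def)
      have "m \<in> words 4"
        using encodes_run(2)[OF FA_encodes \<psi> t(3,4)] y(1) by (simp add: m_def in_words_iff)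
      then have m: "S_word S m = ?\<psi> (S i) * S_word S n"
        using FA_encodes c(1) by (auto simp: encodes_def)
      have "S_word S y = ?\<psi> (S_word S m) * S_word S (final_state FA_perm (take 3 y) (drop 3 y))"
        using encodes_run(1)[OF FA_encodes \<psi> t(3,4)] by (simp add: m_def)
      also have "\<dots> = ?\<psi> (?\<psi> (S i)) * (?\<psi> (S_word S n) * S_word S (final_state FA_perm (take 3 x) (drop 3 x)))"
        by (simp only: m c(2) star_endo_mult[OF \<psi>] mult.assoc)
      also have "\<dots> = ?\<psi> (?\<psi> (S i)) * S_word S x"
        using encodes_run(1)[OF FA_encodes \<psi> t(1,2)] by (simp add: n_def)
      finally have Sy: "S_word S y = ?\<psi> (?\<psi> (S i)) * S_word S x" .
      have "?v * S i * S_word S w = ?v * S_word S z * S_word S (drop 6 (i # w))"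
        by (metis iw S_word_Cons S_word_append mult.assoc)
      also have "\<dots> = S_word S y"
        by (simp only: perm_unitary_S_word[OF F z] y_def S_word_append)
      finally have "?v * S i * S_word S w = S_word S y" .
      moreover have "?\<psi> (?\<psi> (S i)) * ?v * S_word S w = ?\<psi> (?\<psi> (S i)) * S_word S x"
        by (simp only: mult.assoc perm_unitary_S_word[OF F w] x_def)
      ultimately show "?\<psi> (?\<psi> (S i)) * ?v * S_word S w = ?v * S i * S_word S w"
        by (simp only: Sy)
    qed
    then have "?\<psi> (?\<psi> (S i)) * (?v * adj ?v) = ?v * S i * adj ?v"
      by (simp only: mult.assoc[symmetric])
    then show ?thesis using v by (simp add: is_unitary_def Ad_def)
  qed
  have "star_endomorphism (Ad ?v)" using Ad_in_Aut[OF v] by (simp add: Aut_def)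
  then show ?thesis
    by (intro star_endo_eqI[OF S star_endo_comp[OF \<psi> \<psi>]] gen) auto
qed

lemma F_Aut: "\<Lambda>F \<in> carrier Aut"
  using endo_F o_bij[OF F_square F_square] by (simp add: Aut_def)

text \<open>
  The square of \<open>\<lambda>\<^sub>F \<circ> \<lambda>\<^sub>A\<close> is bijective, hence so is \<open>\<lambda>\<^sub>F \<circ> \<lambda>\<^sub>A\<close>, and composing once more with the involution \<open>\<lambda>\<^sub>F\<close>
  gives \<open>\<lambda>\<^sub>A\<close>.
\<close>
lemma A_Aut: "\<Lambda>A \<in> carrier Aut"
proof -
  let ?\<psi> = "\<Lambda>F \<circ> \<Lambda>A"
  have "bij (?\<psi> \<circ> ?\<psi>)"
    using Ad_in_Aut[OF perm_unitary_unitary[OF cuntz_O2_family[OF S] V_perm_bij]]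
    by (simp add: FA_square Aut_def)
  then have "inj ?\<psi>" "surj ?\<psi>"
    unfolding bij_def by (auto dest: inj_on_imageI2)
  then have "bij ?\<psi>" by (rule bijI)
  moreover have "bij \<Lambda>F" using F_Aut by (simp add: Aut_def)
  ultimately have "bij (\<Lambda>F \<circ> ?\<psi>)" by (rule bij_comp)
  moreover have "\<Lambda>F \<circ> ?\<psi> = \<Lambda>A" by (simp only: o_assoc F_square id_o)
  ultimately have "bij \<Lambda>A" by (simp only:)
  then show ?thesis using endo_A by (simp add: Aut_def)
qed

end

section \<open>A criterion for being outer\<close>

lemma S_word_mismatch:
  assumes S: "cuntz_family S" and "set \<alpha> \<subseteq> {1,2}" "set \<beta> \<subseteq> {1,2}"
    and i: "i < length \<alpha>" "i < length \<beta>" "\<alpha> ! i \<noteq> \<beta> ! i"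
  shows "adj (S_word S \<alpha>) * S_word S \<beta> = 0"
proof -
  let ?t = "take (Suc i)" and ?d = "drop (Suc i)"
  have w: "?t \<alpha> \<in> words (Suc i)" "?t \<beta> \<in> words (Suc i)"
    using assms by (auto simp: in_words_iff dest: in_set_takeD)
  have "?t \<alpha> ! i \<noteq> ?t \<beta> ! i" using i by simp
  then have n: "?t \<alpha> \<noteq> ?t \<beta>" by metis
  have "adj (S_word S (?t \<alpha> @ ?d \<alpha>)) * S_word S (?t \<beta> @ ?d \<beta>)
      = adj (S_word S (?d \<alpha>)) * (adj (S_word S (?t \<alpha>)) * S_word S (?t \<beta>)) * S_word S (?d \<beta>)"
    unfolding S_word_append adj_mult by (simp only: mult.assoc)
  also have "\<dots> = 0" by (simp only: S_word_orth[OF S w] n if_False mult_zero_left mult_zero_right)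
  finally show ?thesis by simp
qed

text \<open>
  Close to \<open>u\<close> there is a finite sum of terms \<open>c S\<^sub>\<gamma> S\<^sub>\<epsilon>\<^sup>*\<close>. For long words, \<open>S\<^sub>\<alpha>\<^sup>* S\<^sub>\<gamma> S\<^sub>\<epsilon>\<^sup>* S\<^sub>\<delta> \<noteq> 0\<close> only if
  one of \<open>\<alpha>\<close> and \<open>\<delta>\<close> begins with the other once the first \<open>\<bar>\<gamma>\<bar>\<close> letters of \<open>\<alpha>\<close> and \<open>\<bar>\<epsilon>\<bar>\<close> letters of \<open>\<delta>\<close> are
  removed. In other words, an inner automorphism that acts on the Cantor space moves every point inside its
  tail equivalence class. The hypothesis says that this fails for all lengths up to any given bound \<open>B\<close>.
\<close>
lemma not_inner_if_incomparable:
  fixes S :: "nat \<Rightarrow> 'a::unital_cstar_algebra"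
  assumes S: "cuntz_O2 S" and u: "is_unitary u"
    and *: "\<And>B. \<exists>\<alpha> \<delta> R. set \<alpha> \<subseteq> {1,2} \<and> set \<delta> \<subseteq> {1,2} \<and> S_word S \<alpha> = Ad u (S_word S \<delta>) * R \<and>
      (\<forall>a\<le>B. \<forall>b\<le>B. \<exists>i. a + i < length \<alpha> \<and> b + i < length \<delta> \<and> \<alpha> ! (a + i) \<noteq> \<delta> ! (b + i))"
  shows False
proof -
  note F = cuntz_O2_family[OF S]
  obtain m p p' where p: "graded S S m p p'" "norm (u - p) < 1"
    using graded_dense[OF S, of 1 u] by auto
  obtain q r where q: "\<And>j. j \<in> {- int m..int m} \<Longrightarrow> homogeneous S S j (q j) (r j)"
    "p = (\<Sum>j\<in>{- int m..int m}. q j)"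
    using gradedE[OF F F p(1)] by metis
  have "\<forall>j\<in>{- int m..int m}. \<exists>ab. corr S S (fst ab) (snd ab) (q j) (r j)"
    using q(1) unfolding homogeneous_def by force
  then obtain f where f: "\<And>j. j \<in> {- int m..int m} \<Longrightarrow> corr S S (fst (f j)) (snd (f j)) (q j) (r j)"
    by metis
  have "\<exists>B. \<forall>j\<in>{- int m..int m}. fst (f j) + snd (f j) \<le> B"
    using finite_nat_set_iff_bounded_le[of "(\<lambda>j. fst (f j) + snd (f j)) ` {- int m..int m}"] by simp
  then obtain B where B: "\<And>j. j \<in> {- int m..int m} \<Longrightarrow> fst (f j) + snd (f j) \<le> B" by blast
  obtain \<alpha> \<delta> R where w: "set \<alpha> \<subseteq> {1,2}" "set \<delta> \<subseteq> {1,2}"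
    and R: "S_word S \<alpha> = Ad u (S_word S \<delta>) * R"
    and inc: "\<And>a b. a \<le> B \<Longrightarrow> b \<le> B \<Longrightarrow>
      \<exists>i. a + i < length \<alpha> \<and> b + i < length \<delta> \<and> \<alpha> ! (a + i) \<noteq> \<delta> ! (b + i)"
    using *[of B] by blast
  let ?A = "S_word S \<alpha>" and ?D = "S_word S \<delta>"
  have uu: "adj u * u = 1" "u * adj u = 1" using u by (auto simp: is_unitary_def)
  have qz: "adj ?A * q j * ?D = 0" if j: "j \<in> {- int m..int m}" for j
  proof -
    define a b where "a = fst (f j)" and "b = snd (f j)"
    have "a \<le> B" "b \<le> B" using B[OF j] by (auto simp: a_def b_def)
    then obtain i where i: "a + i < length \<alpha>" "b + i < length \<delta>" "\<alpha> ! (a + i) \<noteq> \<delta> ! (b + i)"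
      using inc by blast
    have t: "take a \<alpha> \<in> words a" "take b \<delta> \<in> words b"
      using w i by (auto simp: in_words_iff dest: in_set_takeD)
    then obtain c where c: "adj (S_word S (take a \<alpha>)) * q j * S_word S (take b \<delta>) = scaleC c 1"
      using f[OF j] unfolding corr_def a_def b_def by blast
    have 0: "adj (S_word S (drop a \<alpha>)) * S_word S (drop b \<delta>) = 0"
      by (rule S_word_mismatch[OF F _ _ , of _ _ i])
         (use w i in \<open>auto dest: in_set_dropD\<close>)
    have "adj (S_word S (take a \<alpha> @ drop a \<alpha>)) * q j * S_word S (take b \<delta> @ drop b \<delta>)
      = adj (S_word S (drop a \<alpha>)) * (adj (S_word S (take a \<alpha>)) * q j * S_word S (take b \<delta>)) * S_word S (drop b \<delta>)"
      unfolding S_word_append adj_mult by (simp only: mult.assoc)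
    also have "\<dots> = scaleC c (adj (S_word S (drop a \<alpha>)) * S_word S (drop b \<delta>))"
      unfolding c by (simp add: scaleC_mult_left scaleC_mult_right)
    finally show ?thesis by (simp add: 0)
  qed
  have p0: "adj ?A * p * ?D = 0"
    unfolding q(2) sum_distrib_left sum_distrib_right by (rule sum.neutral) (use qz in blast)
  have iA: "adj ?A * ?A = 1" and iD: "adj ?D * ?D = 1"
    using S_word_isometry[OF F] w by auto
  have AdD: "Ad u ?D = u * ?D * adj u" by (simp add: Ad_def)
  have "adj (Ad u ?D) * Ad u ?D = 1"
  proof -
    have "adj (Ad u ?D) * Ad u ?D = u * (adj ?D * (adj u * u) * ?D) * adj u"
      unfolding AdD adj_mult adj_adj by (simp only: mult.assoc)
    then show ?thesis by (simp add: uu iD)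
  qed
  then have "R = adj (Ad u ?D) * ?A" unfolding R by (simp flip: mult.assoc)
  also have "\<dots> = u * (adj ?D * (adj u * ?A))"
    unfolding AdD adj_mult adj_adj by (simp only: mult.assoc)
  finally have Re: "R = u * (adj ?D * (adj u * ?A))" .
  have n: "norm u \<le> 1" "norm ?A \<le> 1" "norm ?D \<le> 1"
    using norm_le_one_if_isometry uu(1) iA iD by auto
  have n2: "norm (x * y) \<le> 1" if "norm x \<le> 1" "norm y \<le> 1" for x y :: 'a
    by (rule order_trans[OF norm_mult_ineq mult_le_one]) (use that in auto)
  have nR: "norm R \<le> 1" unfolding Re by (intro n2) (simp_all add: n)
  have "1 = adj ?A * ?A" by (simp add: iA)
  also have "\<dots> = adj ?A * u * ?D * adj u * R"
    using R unfolding AdD by (metis mult.assoc)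
  also have "\<dots> = adj ?A * (u - p) * ?D * adj u * R"
    by (simp only: right_diff_distrib left_diff_distrib p0) simp
  finally have e: "1 = (adj ?A * (u - p)) * (?D * (adj u * R))"
    by (simp only: mult.assoc)
  have "norm (?D * (adj u * R)) \<le> 1"
    by (intro n2) (simp_all add: n nR)
  then have "norm ((adj ?A * (u - p)) * (?D * (adj u * R))) \<le> norm (adj ?A * (u - p))"
    using norm_mult_ineq[of "adj ?A * (u - p)" "?D * (adj u * R)"]
    by (meson mult_left_le norm_ge_zero order_trans)
  also have "\<dots> \<le> norm (adj ?A) * norm (u - p)" by (rule norm_mult_ineq)
  also have "\<dots> \<le> 1 * norm (u - p)" by (rule mult_right_mono) (simp_all add: n)
  finally have "1 \<le> norm (u - p)" using e by (metis mult_1 norm_one)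
  then show False using p by simp
qed

section \<open>Moving defects and infinite order\<close>

definition moves :: "nat list \<Rightarrow> nat list \<Rightarrow> nat list \<Rightarrow> nat list \<Rightarrow> bool" where
  "moves s w v s' \<longleftrightarrow> emit A_perm s w = v \<and> final_state A_perm s w = s'"

lemma emit_append: "emit \<tau> s (w @ w') = emit \<tau> s w @ emit \<tau> (final_state \<tau> s w) w'"
  and final_state_append: "final_state \<tau> s (w @ w') = final_state \<tau> (final_state \<tau> s w) w'"
  by (induction w arbitrary: s) simp_all

lemma moves_append:
  "moves s w v s' \<Longrightarrow> moves s' w' v' s'' \<Longrightarrow> moves s (w @ w') (v @ v') s''"
  by (simp add: moves_def emit_append final_state_append)

lemma moves_Nil: "moves s [] [] s" by (simp add: moves_def)

lemma moves_replicate: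
  "moves s w v s \<Longrightarrow> moves s (concat (replicate n w)) (concat (replicate n v)) s"
  by (induction n) (simp_all add: moves_Nil moves_append)

lemma moves_basic:
  "moves [2,2,1] [2,1] [2,1] [2,2,1]" "moves [2,2,1] [1,2] [2,1] [1,2,2]"
  "moves [1,2,2] [1,2] [1,2] [1,2,2]" "moves [1,2,2] [2,1,2,1] [1,2,1,2] [2,2,1]"
  "moves [2,1,2] [1] [2] [2,2,1]"
  by (simp_all add: moves_def A_perm_def A_table_def)

abbreviation "r12 n \<equiv> concat (replicate n [1, 2 :: nat])"
abbreviation "r21 n \<equiv> concat (replicate n [2, 1 :: nat])"

text \<open>
  The background \<open>121212...\<close> is interrupted by one defect \<open>22\<close>, where \<open>r12 p\<close> meets \<open>r21 q\<close>, and one defect \<open>11\<close>,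
  where \<open>r21 q\<close> meets the next period; the gap between them is governed by \<open>p\<close>. The outer factors \<open>r21 k\<close> and
  \<open>r21 t\<close> supply the letters that are lost at the two ends when the transducer runs.
\<close>
definition defect_word :: "nat \<Rightarrow> nat \<Rightarrow> nat \<Rightarrow> nat \<Rightarrow> nat \<Rightarrow> nat list" where
  "defect_word k p q N t = r21 k @ concat (replicate N (r12 p @ r21 q)) @ r21 t"

lemma concat_replicate_rotate:
  "concat (replicate n (x @ y)) @ x = x @ concat (replicate n (y @ x))"
  by (induction n) simp_all

lemma concat_replicate_commute: "concat (replicate n x) @ x = x @ concat (replicate n x)"
  using concat_replicate_rotate[of n x "[]"] by simp

text \<open>
  The state \<open>221\<close> copies the background \<open>21\<close>, a defect \<open>11\<close> switches to the state \<open>122\<close>, which copies \<open>12\<close> until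
  a defect \<open>22\<close> switches back. The two switches act on different amounts of the background, so the gap grows by one
  period \<open>12\<close>.
\<close>
lemma moves_block:
  "moves [2,2,1] (r12 (Suc p) @ r21 (Suc (Suc q))) ([2,1] @ r12 (Suc (Suc p)) @ r21 q) [2,2,1]"
proof -
  have "moves [2,2,1] ([1,2] @ r12 p @ [2,1,2,1] @ r21 q) ([2,1] @ r12 p @ [1,2,1,2] @ r21 q) [2,2,1]"
    by (intro moves_append[OF moves_basic(2)] moves_append[OF moves_replicate[OF moves_basic(3)]]
        moves_append[OF moves_basic(4)] moves_replicate[OF moves_basic(1)])
  moreover have "[1,2] @ r12 p @ [2,1,2,1] @ r21 q = r12 (Suc p) @ r21 (Suc (Suc q))" by simp
  moreover have "r12 p @ [1,2,1,2] = r12 (Suc (Suc p))"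
    using concat_replicate_commute[of p "[1,2::nat]"] by simp
      (metis append.assoc append_Cons append_Nil)
  then have "r12 p @ [1,2,1,2] @ r21 q = r12 (Suc (Suc p)) @ r21 q" by (metis append.assoc)
  ultimately show ?thesis by (simp only:)
qed

lemma moves_defect_word:
  "moves [2,2,1] (defect_word k (Suc p) (Suc (Suc q)) N (Suc t)) (defect_word (Suc k) (Suc (Suc p)) (Suc q) N t) [2,2,1]"
proof -
  let ?b = "r12 (Suc (Suc p)) @ r21 q"
  have "moves [2,2,1] (defect_word k (Suc p) (Suc (Suc q)) N (Suc t))
      (r21 k @ concat (replicate N ([2,1] @ ?b)) @ r21 (Suc t)) [2,2,1]"
    unfolding defect_word_def
    by (intro moves_append[of _ _ _ "[2,2,1]"] moves_replicate moves_basic(1) moves_block)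
  also have "r21 k @ concat (replicate N ([2,1] @ ?b)) @ r21 (Suc t)
      = r21 k @ (concat (replicate N ([2,1] @ ?b)) @ [2,1]) @ r21 t" by simp
  also have "\<dots> = (r21 k @ [2,1]) @ concat (replicate N (?b @ [2,1])) @ r21 t"
    unfolding concat_replicate_rotate by simp
  also have "\<dots> = defect_word (Suc k) (Suc (Suc p)) (Suc q) N t"
    unfolding defect_word_def append_assoc concat_replicate_commute[of k "[2,1::nat]"]
      concat_replicate_commute[of q "[2,1::nat]"] by simp
  finally show ?thesis .
qed

lemma defect_word_Suc: "defect_word (Suc k) p q N t = [2,1] @ defect_word k p q N t"
  by (simp add: defect_word_def)

text \<open>
  The first three letters of a word serve as the initial state. They are \<open>212\<close> here and not the state \<open>221\<close>
  that copies the background, but \<open>212\<close> passes to \<open>221\<close> after one letter and the word it emits begins with \<open>221\<close>. So after two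
  applications of \<open>\<lambda>\<^sub>A\<close> the original form is restored.
\<close>
lemma emit_defect_word_twice:
  shows "defect_word (Suc (Suc k)) (Suc p) (Suc (Suc (Suc q))) N (Suc (Suc t)) = [2,1,2] @ w \<Longrightarrow>
     emit A_perm [2,1,2] w = [2,2,1] @ defect_word k (Suc (Suc p)) (Suc (Suc q)) N (Suc t)"
    and "emit A_perm [2,2,1] (defect_word k (Suc (Suc p)) (Suc (Suc q)) N (Suc t))
      = defect_word (Suc k) (Suc (Suc (Suc p))) (Suc q) N t"
proof -
  show "emit A_perm [2,2,1] (defect_word k (Suc (Suc p)) (Suc (Suc q)) N (Suc t))
      = defect_word (Suc k) (Suc (Suc (Suc p))) (Suc q) N t"
    using moves_defect_word by (simp add: moves_def)
  assume "defect_word (Suc (Suc k)) (Suc p) (Suc (Suc (Suc q))) N (Suc (Suc t)) = [2,1,2] @ w"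
  then have w: "w = [1] @ defect_word k (Suc p) (Suc (Suc (Suc q))) N (Suc (Suc t))"
    by (simp add: defect_word_Suc)
  have "moves [2,1,2] w ([2] @ defect_word (Suc k) (Suc (Suc p)) (Suc (Suc q)) N (Suc t)) [2,2,1]"
    unfolding w by (rule moves_append[OF moves_basic(5) moves_defect_word])
  then show "emit A_perm [2,1,2] w = [2,2,1] @ defect_word k (Suc (Suc p)) (Suc (Suc q)) N (Suc t)"
    by (simp add: moves_def defect_word_Suc)
qed

lemma set_defect_word: "set (defect_word k p q N t) \<subseteq> {1,2}"
  by (auto simp: defect_word_def set_replicate_conv_if split: if_splits)

context
  fixes S :: "nat \<Rightarrow> 'a::unital_cstar_algebra"
  assumes S: "cuntz_O2 S"
begin

lemma star_endo_funpow: "star_endomorphism \<phi> \<Longrightarrow> star_endomorphism (\<phi> ^^ n)"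
proof (induction n)
  case 0 then show ?case by (simp add: star_endomorphism_def)
qed (simp add: star_endo_comp)

text \<open>
  The \<open>n\<close>-th iterate of the homeomorphism induced by \<open>\<lambda>\<^sub>A\<close> sends the infinite words that begin with \<open>\<alpha>\<close> to
  infinite words that begin with \<open>\<delta>\<close>.
\<close>
definition reach :: "nat \<Rightarrow> nat list \<Rightarrow> nat list \<Rightarrow> bool" where
  "reach n \<alpha> \<delta> \<longleftrightarrow> (\<exists>R. S_word S \<alpha> =
     ((cuntz_endo S (perm_unitary S 4 A_perm)) ^^ n) (S_word S \<delta>) * R)"

lemma reach_0: "reach 0 \<alpha> \<alpha>"
  unfolding reach_def by (intro exI[of _ 1]) simp

lemma reach_Suc:
  assumes r: "reach n \<alpha> (s @ w)" and s: "s \<in> words 3" "set w \<subseteq> {1,2}"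
  shows "reach (Suc n) \<alpha> (emit A_perm s w)"
proof -
  let ?\<phi> = "cuntz_endo S (perm_unitary S 4 A_perm)"
  obtain R where R: "S_word S \<alpha> = (?\<phi> ^^ n) (S_word S (s @ w)) * R"
    using r unfolding reach_def by blast
  have "S_word S (s @ w) = ?\<phi> (S_word S (emit A_perm s w)) * S_word S (final_state A_perm s w)"
    by (rule encodes_run(1)[OF A_encodes[OF S] endo_A[OF S] s])
  then have "S_word S \<alpha> = (?\<phi> ^^ n) (?\<phi> (S_word S (emit A_perm s w))) *
      ((?\<phi> ^^ n) (S_word S (final_state A_perm s w)) * R)"
    using R star_endo_mult[OF star_endo_funpow[OF endo_A[OF S]]] by (simp add: mult.assoc)
  then show ?thesis unfolding reach_def by (auto simp: funpow_swap1)
qed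

lemma reach_defect_word:
  assumes "j \<le> n"
  shows "reach (2 * j) (defect_word (Suc n) 1 (Suc (2 * n)) N (2 * n))
    (defect_word (Suc (n - j)) (Suc (2 * j)) (Suc (2 * (n - j))) N (2 * (n - j)))"
  using assms
proof (induction j)
  case 0
  show ?case using reach_0 by simp
next
  case (Suc j)
  define k where "k = n - Suc j"
  have k: "n - j = Suc k" using Suc.prems by (simp add: k_def)
  let ?\<alpha> = "defect_word (Suc n) 1 (Suc (2 * n)) N (2 * n)"
  let ?\<delta> = "defect_word (Suc (Suc k)) (Suc (2 * j)) (Suc (Suc (Suc (2 * k)))) N (Suc (Suc (2 * k)))"
  have 1: "reach (2 * j) ?\<alpha> ?\<delta>" using Suc by (simp add: k)
  obtain w where w: "?\<delta> = [2,1,2] @ w" by (simp add: defect_word_Suc)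
  have "set ([2,1,2] @ w) \<subseteq> {1,2}" unfolding w[symmetric] by (rule set_defect_word)
  then have sw: "set w \<subseteq> {1,2}" by simp
  have "reach (Suc (2 * j)) ?\<alpha> ([2,2,1] @ defect_word k (Suc (Suc (2 * j))) (Suc (Suc (2 * k))) N (Suc (2 * k)))"
    using reach_Suc[OF 1[unfolded w] _ sw] unfolding emit_defect_word_twice(1)[OF w]
    by (simp add: in_words_iff)
  from reach_Suc[OF this _ set_defect_word]
  have "reach (Suc (Suc (2 * j))) ?\<alpha> (defect_word (Suc k) (Suc (Suc (Suc (2 * j)))) (Suc (2 * k)) N (2 * k))"
    unfolding emit_defect_word_twice(2) by (simp add: in_words_iff)
  then show ?case by (simp add: k_def)
qed

end

lemma nth_concat_replicate:
  "i < N * length w \<Longrightarrow> concat (replicate N w) ! i = w ! (i mod length w)"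
proof (induction N arbitrary: i)
  case (Suc N)
  show ?case
  proof (cases "i < length w")
    case False
    then have "concat (replicate N w) ! (i - length w) = w ! ((i - length w) mod length w)"
      using Suc by (intro Suc.IH) auto
    then show ?thesis using False by (simp add: nth_append le_mod_geq)
  qed (simp add: nth_append)
qed simp

lemma length_concat_replicate: "length (concat (replicate N w)) = N * length w"
  by (induction N) simp_all

text \<open>
  In a block \<open>r12 p @ r21 q\<close> the roles of even and odd positions are exchanged at position \<open>2 p\<close>.
\<close>
definition block_letter :: "nat \<Rightarrow> nat \<Rightarrow> nat" where
  "block_letter p r = (if even r \<longleftrightarrow> r < 2 * p then 1 else 2)"

lemma length_pair: "length [a, b] = 2"
  by simp

lemma nth_block:
  assumes "r < 2 * p + 2 * q"
  shows "(r12 p @ r21 q) ! r = block_letter p r"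
proof (cases "r < 2 * p")
  case True
  then have "(r12 p @ r21 q) ! r = [1, 2] ! (r mod 2)"
    using nth_concat_replicate[of r p "[1, 2::nat]", unfolded length_pair]
    by (simp add: nth_append length_concat_replicate mult.commute)
  also have "\<dots> = block_letter p r"
    using True by (cases "even r") (auto simp: block_letter_def odd_iff_mod_2_eq_one even_iff_mod_2_eq_zero)
  finally show ?thesis .
next
  case False
  define s where "s = r - 2 * p"
  have r: "r = 2 * p + s" "s < q * 2" using False assms by (simp_all add: s_def)
  then have "(r12 p @ r21 q) ! r = [2, 1] ! (s mod 2)"
    using nth_concat_replicate[of s q "[2, 1::nat]", unfolded length_pair]
    by (simp add: nth_append length_concat_replicate mult.commute)
  also have "\<dots> = block_letter p r"
    using r by (cases "even s") (auto simp: block_letter_def odd_iff_mod_2_eq_one even_iff_mod_2_eq_zero)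
  finally show ?thesis .
qed

lemma nth_defect_word:
  assumes "e < N * (2 * p + 2 * q)"
  shows "2 * k + e < length (defect_word k p q N t)"
    and "defect_word k p q N t ! (2 * k + e) = block_letter p (e mod (2 * p + 2 * q))"
proof -
  let ?b = "r12 p @ r21 q"
  have l: "length ?b = 2 * p + 2 * q" by (simp add: length_concat_replicate)
  have lk: "length (r21 k) = 2 * k" by (simp add: length_concat_replicate)
  have lb: "length (concat (replicate N ?b)) = N * (2 * p + 2 * q)"
    unfolding length_concat_replicate l ..
  show "2 * k + e < length (defect_word k p q N t)"
    unfolding defect_word_def length_append lk lb using assms by simp
  have pos: "2 * p + 2 * q > 0" using assms by (cases "2 * p + 2 * q = 0") auto
  have "defect_word k p q N t ! (2 * k + e) = (concat (replicate N ?b) @ r21 t) ! e"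
    unfolding defect_word_def by (metis lk nth_append_length_plus)
  also have "\<dots> = concat (replicate N ?b) ! e"
    using assms unfolding lb[symmetric] by (rule nth_append_left)
  also have "\<dots> = ?b ! (e mod (2 * p + 2 * q))"
    using nth_concat_replicate[of e N ?b] assms unfolding l by simp
  also have "\<dots> = block_letter p (e mod (2 * p + 2 * q))"
    by (rule nth_block) (use pos in simp)
  finally show "defect_word k p q N t ! (2 * k + e) = block_letter p (e mod (2 * p + 2 * q))" .
qed

text \<open>
  The pattern \<open>1122\<close> does not occur in the periodic word whose gap is governed by \<open>2 n + 1\<close>: there the pair \<open>11\<close> occupies
  the end of one block and the beginning of the next, which forces the pair \<open>22\<close> to lie at a distance of more than two letters.
\<close>
lemma block_mismatch:
  assumes n: "n \<ge> 1" and L: "L = 4 * n + 4"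
    and 1: "block_letter (Suc (2 * n)) (e mod L) = 1" "block_letter (Suc (2 * n)) ((e + 1) mod L) = 1"
    and 2: "block_letter (Suc (2 * n)) ((e + 2) mod L) = 2" "block_letter (Suc (2 * n)) ((e + 3) mod L) = 2"
  shows False
proof -
  define r where "r = e mod L"
  have r: "r < L" using L by (simp add: r_def)
  have m: "(e + c) mod L = (if r + c < L then r + c else r + c - L)" if "c \<le> 3" for c
  proof -
    have "(e + c) mod L = (r + c) mod L" by (simp add: r_def mod_add_left_eq)
    also have "\<dots> = (if r + c < L then r + c else r + c - L)"
      using r that L n by (simp add: le_mod_geq)
    finally show ?thesis .
  qed
  have b: "block_letter p s = 1 \<longleftrightarrow> (even s \<longleftrightarrow> s < 2 * p)" "block_letter p s = 2 \<longleftrightarrow> (even s \<longleftrightarrow> \<not> s < 2 * p)" for p s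
    by (auto simp: block_letter_def)
  have a: "even r \<longleftrightarrow> r < 4 * n + 2" using 1(1) unfolding b r_def[symmetric] by simp
  show False
  proof (cases "r = L - 1")
    case True
    then have "(e + 3) mod L = 2" using m[of 3] L by simp
    then show False using 2(2) n unfolding b by simp
  next
    case False
    then have "(e + 1) mod L = r + 1" using m[of 1] r by simp
    then have "odd r \<longleftrightarrow> r + 1 < 4 * n + 2" using 1(2) unfolding b by simp
    with a have "r = 4 * n + 1 \<or> \<not> r < 4 * n + 2" by presburger
    then show False using a False r L by presburger
  qed
qed

text \<open>
  Both words are periodic with period \<open>L = 4 n + 4\<close> up to their ends, but \<open>22\<close> immediately follows \<open>11\<close> only in the
  first one. The number of periods is large enough to find a full period behind any \<open>B\<close> leading letters.
\<close>
lemma defect_words_incomparable: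
  assumes n: "n \<ge> 1" and ab: "a \<le> B" "b \<le> B"
  defines "\<alpha> \<equiv> defect_word (Suc n) 1 (Suc (2 * n)) (2 * B + 4) (2 * n)"
    and "\<delta> \<equiv> defect_word 1 (Suc (2 * n)) 1 (2 * B + 4) 0"
  shows "\<exists>i. a + i < length \<alpha> \<and> b + i < length \<delta> \<and> \<alpha> ! (a + i) \<noteq> \<delta> ! (b + i)"
proof (rule ccontr)
  assume "\<not> ?thesis"
  then have eq: "\<alpha> ! (a + i) = \<delta> ! (b + i)" if "a + i < length \<alpha>" "b + i < length \<delta>" for i
    using that by blast
  define L where "L = 4 * n + 4"
  define K where "K = (B + 1) * L"
  \<comment> \<open>Counted from the end of the leading factor, the pattern \<open>1122\<close> of \<open>\<alpha>\<close> begins one letter before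
    the block with the number \<open>B + 1\<close>, counted from \<open>0\<close>; \<open>e\<close> is the place opposite to it in \<open>\<delta>\<close>.\<close>
  define M where "M = K - 1"
  have "4 * (B + 1) \<le> L * (B + 1)" by (rule mult_right_mono) (simp_all add: L_def)
  then have BL: "K \<ge> 4 * B + 4" by (simp add: K_def algebra_simps)
  have N: "(2 * B + 4) * L = 2 * K + 2 * L" by (simp add: K_def algebra_simps)
  have L\<alpha>: "2 * 1 + 2 * Suc (2 * n) = L" and L\<delta>: "2 * Suc (2 * n) + 2 * 1 = L"
    by (simp_all add: L_def)
  define e where "e = M + 2 * n + b - a"
  have small: "M + c < (2 * B + 4) * L" "e + c < (2 * B + 4) * L" if "c \<le> 3" for c
    using that ab BL L_def unfolding N M_def e_def by linarith+
  have step: "block_letter (Suc (2 * n)) ((e + c) mod L) = block_letter 1 ((M + c) mod L)" if c: "c \<le> 3" for c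
  proof -
    define i where "i = 2 * n + 2 + M + c - a"
    have i: "a + i = 2 * Suc n + (M + c)" "b + i = 2 * 1 + (e + c)"
      using ab BL by (simp_all add: i_def M_def e_def)
    have "\<alpha> ! (a + i) = \<delta> ! (b + i)"
      unfolding i \<alpha>_def \<delta>_def
      by (rule eq[unfolded \<alpha>_def \<delta>_def i, of i, unfolded i])
         (intro nth_defect_word(1); use small[OF c] in \<open>simp only: L\<alpha> L\<delta>\<close>)+
    then show ?thesis
      unfolding i \<alpha>_def \<delta>_def
      using nth_defect_word(2)[of "M + c" "2 * B + 4" 1 "Suc (2 * n)" "Suc n" "2 * n"]
        nth_defect_word(2)[of "e + c" "2 * B + 4" "Suc (2 * n)" 1 1 0] small[OF c]
      unfolding L\<alpha> L\<delta> by simp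
  qed
  have M: "M mod L = L - 1" "(M + 1) mod L = 0" "(M + 2) mod L = 1" "(M + 3) mod L = 2"
  proof -
    have "L \<ge> 4" by (simp add: L_def)
    then have "M = (L - 1) + B * L" by (simp add: M_def K_def)
    moreover have "M + 1 = (B + 1) * L" "M + 2 = 1 + (B + 1) * L" "M + 3 = 2 + (B + 1) * L"
      using BL unfolding K_def[symmetric] M_def by linarith+
    ultimately show "M mod L = L - 1" "(M + 1) mod L = 0" "(M + 2) mod L = 1" "(M + 3) mod L = 2"
      using \<open>L \<ge> 4\<close> by (simp_all only: mod_mult_self1 mod_mult_self2_is_0) simp_all
  qed
  show False
  proof (rule block_mismatch[OF n L_def])
    show "block_letter (Suc (2 * n)) (e mod L) = 1" using step[of 0] M(1) by (simp add: block_letter_def L_def)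
    show "block_letter (Suc (2 * n)) ((e + 1) mod L) = 1" using step[of 1] M(2) by (simp add: block_letter_def)
    show "block_letter (Suc (2 * n)) ((e + 2) mod L) = 2" using step[of 2] M(3) by (simp add: block_letter_def)
    show "block_letter (Suc (2 * n)) ((e + 3) mod L) = 2" using step[of 3] M(4) by (simp add: block_letter_def)
  qed
qed

text \<open>
  With \<open>\<lambda>\<^sub>A\<^sup>n\<close> also its square would be inner, whereas \<open>2 n\<close> steps move the defects of suitable words apart.
\<close>
lemma A_power_not_inner:
  assumes S: "cuntz_O2 S" and n: "n \<ge> 1"
  shows "(cuntz_endo S (perm_unitary S 4 A_perm)) ^^ n \<notin> Inn"
proof
  let ?\<phi> = "cuntz_endo S (perm_unitary S 4 A_perm)"
  assume "?\<phi> ^^ n \<in> Inn"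
  then obtain u where u: "is_unitary u" "?\<phi> ^^ n = Ad u" by (auto simp: Inn_def)
  have "?\<phi> ^^ (2 * n) = ?\<phi> ^^ n \<circ> ?\<phi> ^^ n" by (simp only: mult_2 funpow_add)
  then have u2: "?\<phi> ^^ (2 * n) = Ad (u * u)" by (simp add: u(2) Ad_comp)
  show False
  proof (rule not_inner_if_incomparable[OF S is_unitary_mult[OF u(1) u(1)]])
    fix B
    let ?\<alpha> = "defect_word (Suc n) 1 (Suc (2 * n)) (2 * B + 4) (2 * n)"
      and ?\<delta> = "defect_word 1 (Suc (2 * n)) 1 (2 * B + 4) 0"
    have "reach S (2 * n) ?\<alpha> ?\<delta>" using reach_defect_word[OF S order_refl, of n "2 * B + 4"] by simp
    then obtain R where "S_word S ?\<alpha> = Ad (u * u) (S_word S ?\<delta>) * R"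
      unfolding reach_def[OF S] u2 by blast
    then show "\<exists>\<alpha> \<delta> R. set \<alpha> \<subseteq> {1,2} \<and> set \<delta> \<subseteq> {1,2} \<and> S_word S \<alpha> = Ad (u * u) (S_word S \<delta>) * R \<and>
      (\<forall>a\<le>B. \<forall>b\<le>B. \<exists>i. a + i < length \<alpha> \<and> b + i < length \<delta> \<and> \<alpha> ! (a + i) \<noteq> \<delta> ! (b + i))"
      using set_defect_word defect_words_incomparable[OF n] by blast
  qed
qed

section \<open>Generators and relations of the infinite dihedral group\<close>

text \<open>
  The two involutions give \<open>f x\<^sup>n f = x\<^sup>-\<^sup>n\<close>, so that \<open>(n, s) \<mapsto> x\<^sup>n f\<^sup>s\<close> is a homomorphism. It is injective: a power of \<open>x\<close>
  equal to \<open>f\<close> would commute with \<open>x\<close>, which would make \<open>x\<close> an involution.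
\<close>
lemma (in group) generate_iso_infinite_dihedral:
  assumes x: "x \<in> carrier G" and f: "f \<in> carrier G"
    and ff: "f \<otimes> f = \<one>" and fx: "(f \<otimes> x) \<otimes> (f \<otimes> x) = \<one>"
    and inf: "\<And>n::nat. n \<ge> 1 \<Longrightarrow> x [^] n \<noteq> \<one>"
  shows "G\<lparr>carrier := generate G {x, f}\<rparr> \<cong> infinite_dihedral"
proof -
  have inv_f: "inv f = f" using ff f by (simp add: inv_equality)
  have "f \<otimes> x \<otimes> f = inv x"
    using fx x f by (intro inv_equality[symmetric]) (simp_all add: m_assoc)
  have conj: "f \<otimes> x [^] n \<otimes> f = x [^] (- n)" for n :: int
  proof -
    have "(\<lambda>y. f \<otimes> y \<otimes> f) \<in> hom G G"
    proof (rule homI)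
      fix y z assume yz: "y \<in> carrier G" "z \<in> carrier G"
      have "f \<otimes> y \<otimes> f \<otimes> (f \<otimes> z \<otimes> f) = f \<otimes> y \<otimes> ((f \<otimes> f) \<otimes> (z \<otimes> f))"
        using yz f by (simp add: m_assoc)
      then show "f \<otimes> (y \<otimes> z) \<otimes> f = f \<otimes> y \<otimes> f \<otimes> (f \<otimes> z \<otimes> f)"
        using yz f ff by (simp add: m_assoc)
    qed (use f in simp)
    from hom_int_pow[OF this x is_group is_group, of n]
    show ?thesis using x \<open>f \<otimes> x \<otimes> f = inv x\<close> by (simp add: int_pow_inv int_pow_neg)
  qed
  have swap: "f \<otimes> x [^] n = x [^] (- n) \<otimes> f" for n :: int
  proof -
    have "f \<otimes> x [^] n = f \<otimes> x [^] n \<otimes> (f \<otimes> f)" using x f ff by simp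
    also have "\<dots> = (f \<otimes> x [^] n \<otimes> f) \<otimes> f" using x f by (simp add: m_assoc)
    finally show ?thesis by (simp add: conj)
  qed
  have pow_one: "n = 0" if "x [^] n = \<one>" for n :: int
  proof (rule ccontr)
    assume "n \<noteq> 0"
    have "x [^] \<bar>n\<bar> = \<one>" using that x by (cases "n \<ge> 0") (auto simp: int_pow_neg)
    moreover have "x [^] nat \<bar>n\<bar> = x [^] \<bar>n\<bar>"
      by (simp flip: int_pow_int)
    moreover have "1 \<le> nat \<bar>n\<bar>" using \<open>n \<noteq> 0\<close> by simp
    ultimately show False using inf by metis
  qed
  have f_no_pow: "f \<noteq> x [^] n" for n :: int
  proof
    assume fn: "f = x [^] n"
    have "x [^] (1::int) = f \<otimes> x [^] (1::int) \<otimes> f"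
    proof -
      have "f \<otimes> x [^] (1::int) = x [^] (1::int) \<otimes> f"
        unfolding fn by (metis add.commute int_pow_mult x)
      then have "f \<otimes> x [^] (1::int) \<otimes> f = x [^] (1::int) \<otimes> (f \<otimes> f)"
        using x f by (simp add: m_assoc)
      then show ?thesis using x ff by simp
    qed
    also have "\<dots> = x [^] (-1::int)" by (rule conj)
    finally have *: "x [^] (1::int) = x [^] (-1::int)" .
    have "x [^] (2::int) = x [^] (1::int) \<otimes> x [^] (1::int)"
      using int_pow_mult[OF x, of 1 1] by simp
    also have "\<dots> = x [^] (-1::int) \<otimes> x [^] (1::int)" by (rule arg_cong2[OF * refl])
    also have "\<dots> = \<one>" using int_pow_mult[OF x, of "-1" 1] by simp
    finally have "x [^] (2::int) = \<one>" .
    then show False using pow_one by force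
  qed
  define h where "h = (\<lambda>(n::int, s::int). x [^] n \<otimes> (if s = 0 then \<one> else f))"
  have mult: "(m, s) \<otimes>\<^bsub>infinite_dihedral\<^esub> (n, t)
      = (m + (if s = 0 then n else - n), (s + t) mod 2)" for m n s t :: int
    by (simp add: infinite_dihedral_def semidirect_product_def mult_integer_mod_group)
  have hom: "h \<in> hom infinite_dihedral G"
  proof (rule homI)
    fix p assume "p \<in> carrier infinite_dihedral"
    then show "h p \<in> carrier G" using x f by (cases p) (auto simp: h_def)
  next
    fix p q assume "p \<in> carrier infinite_dihedral" "q \<in> carrier infinite_dihedral"
    then obtain m s n t where pq: "p = (m, s)" "q = (n, t)" "s = 0 \<or> s = 1" "t = 0 \<or> t = 1"
      by (auto simp: carrier_infinite_dihedral)
    have conj': "f \<otimes> (x [^] n \<otimes> f) = x [^] (- n)"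
      using conj[of n] x f by (simp add: m_assoc)
    show "h (p \<otimes>\<^bsub>infinite_dihedral\<^esub> q) = h p \<otimes> h q"
      using conj' swap[of n] pq(3,4) x f by (auto simp: pq(1,2) mult h_def int_pow_mult m_assoc)
  qed
  interpret D: group_hom infinite_dihedral G h
    using group_infinite_dihedral hom is_group by (simp add: group_hom_def group_hom_axioms_def)
  have "p = \<one>\<^bsub>infinite_dihedral\<^esub>" if p: "p \<in> carrier infinite_dihedral" "h p = \<one>" for p
  proof -
    obtain n s where ns: "p = (n, s)" "s = 0 \<or> s = 1"
      using p(1) by (auto simp: carrier_infinite_dihedral)
    have "s = 0"
    proof (rule ccontr)
      assume "s \<noteq> 0"
      then have "x [^] n \<otimes> f = \<one>" using p(2) by (simp add: ns h_def)
      then have "inv f = x [^] n" using x f by (intro inv_equality) auto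
      then show False using f_no_pow inv_f by simp
    qed
    then show ?thesis
      using p(2) x pow_one by (simp add: ns h_def infinite_dihedral_def semidirect_product_def)
  qed
  then have inj: "inj_on h (carrier infinite_dihedral)"
    by (intro D.inj_iff_trivial_ker[THEN iffD2]) (auto simp: kernel_def)
  have sub: "{x, f} \<subseteq> carrier G" using x f by simp
  have "h ` carrier infinite_dihedral = generate G {x, f}"
  proof
    have "x [^] n \<otimes> (if s = 0 then \<one> else f) \<in> generate G {x, f}" for n s :: int
      by (intro generate.eng subgroup_int_pow_closed[OF generate_is_subgroup[OF sub]])
         (auto intro: generate.intros)
    then show "h ` carrier infinite_dihedral \<subseteq> generate G {x, f}" by (auto simp: h_def)
    have "x = h (1, 0)" "f = h (0, 1)" using x f by (simp_all add: h_def)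
    then have "{x, f} \<subseteq> h ` carrier infinite_dihedral"
      by (auto simp: carrier_infinite_dihedral)
    then show "generate G {x, f} \<subseteq> h ` carrier infinite_dihedral"
      by (rule generate_subgroup_incl) (rule D.img_is_subgroup)
  qed
  then have "h \<in> iso infinite_dihedral (G\<lparr>carrier := generate G {x, f}\<rparr>)"
    using hom inj by (auto simp: iso_def hom_def bij_betw_def)
  then have "infinite_dihedral \<cong> G\<lparr>carrier := generate G {x, f}\<rparr>" by (rule is_isoI)
  then show ?thesis by (rule group.iso_sym[OF group_infinite_dihedral])
qed

lemma out_class_comp:
  fixes \<phi> \<psi> :: "'a::unital_cstar_algebra \<Rightarrow> 'a"
  assumes "\<phi> \<in> carrier Aut" "\<psi> \<in> carrier Aut"
  shows "out_class \<phi> \<otimes>\<^bsub>Out\<^esub> out_class \<psi> = out_class (\<phi> \<circ> \<psi>)"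
  using hom_mult[OF normal.r_coset_hom_Mod[OF normal_Inn] assms]
  by (simp add: out_class_def Out_def Aut_def)

lemma out_class_eq_one_iff:
  fixes \<phi> :: "'a::unital_cstar_algebra \<Rightarrow> 'a"
  assumes "\<phi> \<in> carrier Aut"
  shows "out_class \<phi> = \<one>\<^bsub>Out\<^esub> \<longleftrightarrow> \<phi> \<in> Inn"
  using group.coset_join1[OF group_Aut _ assms] group.coset_join2[OF group_Aut assms]
    normal_imp_subgroup[OF normal_Inn]
  by (auto simp: out_class_def Out_def FactGroup_def)

theorem corollary5p5:
  fixes S :: "nat \<Rightarrow> 'a::unital_cstar_algebra"
  assumes "cuntz_O2 S"
  shows "(Out :: ('a \<Rightarrow> 'a) set monoid)
           \<lparr>carrier := generate Out
              {out_class (cuntz_endo S (perm_unitary S 4 A_perm)),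
               out_class (cuntz_endo S (F_unitary S))}\<rparr>
         \<cong> infinite_dihedral"
proof -
  let ?A = "cuntz_endo S (perm_unitary S 4 A_perm)" and ?F = "cuntz_endo S (F_unitary S)"
  note A = A_Aut[OF assms] and F = F_Aut[OF assms]
  have grp: "group (Out :: ('a \<Rightarrow> 'a) set monoid)"
    unfolding Out_def by (rule normal.factorgroup_is_group[OF normal_Inn])
  interpret Out: group "Out :: ('a \<Rightarrow> 'a) set monoid" by (rule grp)
  have carr: "out_class \<phi> \<in> carrier Out" if "\<phi> \<in> carrier Aut" for \<phi> :: "'a \<Rightarrow> 'a"
    using hom_in_carrier[OF normal.r_coset_hom_Mod[OF normal_Inn] that]
    by (simp add: out_class_def Out_def)
  have comp: "\<phi> \<circ> \<psi> \<in> carrier Aut" if "\<phi> \<in> carrier Aut" "\<psi> \<in> carrier Aut" for \<phi> \<psi> :: "'a \<Rightarrow> 'a"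
    using that by (auto simp: Aut_def star_endo_comp bij_comp)
  have id: "id \<in> carrier (Aut :: ('a \<Rightarrow> 'a) monoid)"
    by (simp add: Aut_def star_endomorphism_def)
  have Ad: "Ad u \<in> Inn" if "is_unitary u" for u :: 'a using that by (auto simp: Inn_def)
  have "id \<in> (Inn :: ('a \<Rightarrow> 'a) set)"
    using Ad[of 1] by (simp add: Ad_one is_unitary_def)
  then have one: "out_class (id :: 'a \<Rightarrow> 'a) = \<one>\<^bsub>Out\<^esub>"
    by (simp add: out_class_eq_one_iff[OF id])
  have pow_Aut: "?A ^^ n \<in> carrier Aut" for n
  proof (induction n)
    case 0 show ?case using id by (simp only: funpow.simps(1))
  next
    case (Suc n) show ?case using comp[OF A Suc] by (simp only: funpow.simps(2))
  qed
  have pow: "out_class ?A [^]\<^bsub>Out\<^esub> n = out_class (?A ^^ n)" for n :: nat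
  proof (induction n)
    case (Suc n)
    have "out_class ?A [^]\<^bsub>Out\<^esub> Suc n = out_class (?A ^^ n \<circ> ?A)"
      by (simp add: Suc out_class_comp[OF pow_Aut A])
    also have "?A ^^ n \<circ> ?A = ?A ^^ Suc n" by (simp add: funpow_Suc_right del: funpow.simps)
    finally show ?case .
  next
    case 0
    show ?case unfolding funpow.simps(1) one by simp
  qed
  show ?thesis
  proof (rule Out.generate_iso_infinite_dihedral[OF carr[OF A] carr[OF F]])
    show "out_class ?F \<otimes>\<^bsub>Out\<^esub> out_class ?F = \<one>\<^bsub>Out\<^esub>"
      by (simp add: out_class_comp F F_square[OF assms] one)
    have "out_class ?F \<otimes>\<^bsub>Out\<^esub> out_class ?A \<otimes>\<^bsub>Out\<^esub> (out_class ?F \<otimes>\<^bsub>Out\<^esub> out_class ?A)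
        = out_class ((?F \<circ> ?A) \<circ> (?F \<circ> ?A))"
      by (simp only: out_class_comp A F comp)
    also have "\<dots> = out_class (Ad (perm_unitary S 6 V_perm))"
      by (simp only: FA_square[OF assms])
    also have "\<dots> = \<one>\<^bsub>Out\<^esub>"
      using perm_unitary_unitary[OF cuntz_O2_family[OF assms] V_perm_bij]
      by (simp add: out_class_eq_one_iff Ad_in_Aut Ad)
    finally show "out_class ?F \<otimes>\<^bsub>Out\<^esub> out_class ?A \<otimes>\<^bsub>Out\<^esub> (out_class ?F \<otimes>\<^bsub>Out\<^esub> out_class ?A)
        = \<one>\<^bsub>Out\<^esub>" .
    show "out_class ?A [^]\<^bsub>Out\<^esub> n \<noteq> \<one>\<^bsub>Out\<^esub>" if "n \<ge> 1" for n :: nat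
      unfolding pow out_class_eq_one_iff[OF pow_Aut] by (rule A_power_not_inner[OF assms that])
  qed
qed

end
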